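(* Let $n\ge2$, let $(Y_i,Z_i,W_i)\in\mathbb{R}\times[0,1]\times\mathbb{R}^p$, $i=1,\dots,n$, and let $\mu$ be a symmetric probability measure on $\mathbb{R}^p$ with support $\mathbb{R}^p$. For any $\lambda>0$, if all $Z_i$'s are different and all $W_i$'s are different, then the solution $\widehat g$ to the minimization problem $$\min_{g\in\mathcal{G}}\ \int\Big|\frac1n\sum_{i=1}^n(Y_i-g(Z_i))\exp(\mathbf{i}W_i^\top t)\Big|^2d\mu(t)+\lambda\int_0^1|g''(z)|^2dz$$ exists, is unique, and is a natural cubic spline with knots $Z_1,\dots,Z_n$, $$\widehat g(z)=\widehat a_0+\widehat a_1z+\frac1{12}\sum_{i=1}^n\widehat\delta_i|z-Z_i|^3,$$ whose coefficients $\widehat{\bm\delta}=(\widehat\delta_1,\dots,\widehat\delta_n)^T$, $\widehat{\bm a}=(\widehat a_0,\widehat a_1)^T$ are characterized by $$\begin{bmatrix}\widetilde{\bm E}&\bm Z\\ \bm Z^T&\bm 0\end{bmatrix}\begin{pmatrix}\widehat{\bm\delta}\\ \widehat{\bm a}\end{pmatrix}=\begin{pmatrix}\bm Y\\ \bm 0\end{pmatrix},\qquad \widetilde{\bm E}=\bm E+\lambda\bm\Omega^{-1}.$$ Moreover, the vector of values at the knots $\widehat{\bm g}=(\widehat g(Z_1),\dots,\widehat g(Z_n))^T$ is $$\widehat{\bm g}=\big[\bm P+\bm E\widetilde{\bm E}^{-1}(\bm I-\bm P)\big]\bm Y,\qquad \bm P=\bm Z(\bm Z^T\widetilde{\bm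 E}^{-1}\bm Z)^{-1}\bm Z^T\widetilde{\bm E}^{-1}.$$
   Context: $\mathbf{i}$ is the imaginary unit. $\mathcal{G}$ is the set of differentiable functions $g:[0,1]\to\mathbb{R}$ whose first derivative is absolutely continuous (so $g'(z)-g'(0)=\int_0^zg''(t)dt$ with $g''$ integrable). $\omega(w)=\int_{\mathbb{R}^p}\cos(t^\top w)\,d\mu(t)$. Matrix notation: $\bm Y=(Y_1,\dots,Y_n)^T$; $\bm Z$ is the $n\times2$ matrix with $i$-th row $(1,Z_i)$; $\bm E$ is the $n\times n$ matrix with entries $\frac1{12}|Z_i-Z_j|^3$; $\bm\Omega$ is the $n\times n$ matrix with entries $n^{-2}\omega(W_i-W_j)$ (positive definite, hence invertible, when all $W_i$'s are different); $\bm I$ is the $n\times n$ identity matrix. A natural cubic spline with knots $Z_1,\dots,Z_n$ is a function that is a cubic polynomial between consecutive knots, is twice continuously differentiable, and is affine outside the range of the knots (zero second and third derivatives there); equivalently, a function of the form $a_0+a_1z+\frac1{12}\sum_{i=1}^n\delta_i|z-Z_i|^3$ with $\sum_i\delta_i=\sum_i\delta_iZ_i=0$.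
   Formalization: The closed formula for the values at the knots is stated only when the matrix E + λΩ^{-1} is invertible; it can be singular for exceptional λ>0 (e.g. n=2, λ=|Z1-Z2|^3(1-ω(W1-W2))/48), where the formula is undefined. *)

theory Defs
  imports "HOL-Probability.Probability" "HOL-Computational_Algebra.Polynomial"
begin

section \<open>The function class and the criterion\<close>

text \<open>
  Functions on the unit interval are represented by members of
  \<^term>\<open>extensional {0..1::real}\<close>, so that equality of representatives is equality on the
  unit interval. Derivatives are taken within the interval (one-sided at the end points).
\<close>

definition first_deriv :: "(real \<Rightarrow> real) \<Rightarrow> real \<Rightarrow> real" where
  "first_deriv g z = vector_derivative g (at z within {0..1})"

text \<open>Absolute continuity on the unit interval: \<open>f\<close> is the indefinite Lebesgue integral of \<open>h\<close>.\<close>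

definition ac_density :: "(real \<Rightarrow> real) \<Rightarrow> (real \<Rightarrow> real) \<Rightarrow> bool" where
  "ac_density f h \<longleftrightarrow>
     set_integrable lborel {0..1} h \<and>
     (\<forall>z\<in>{0..1}. f z - f 0 = (LINT t:{0..z}|lborel. h t))"

definition function_class :: "(real \<Rightarrow> real) set" where
  "function_class =
     {g \<in> extensional {0..1}.
        (\<forall>z\<in>{0..1}. g differentiable (at z within {0..1})) \<and>
        (\<exists>h. ac_density (first_deriv g) h)}"

text \<open>
  The density is determined almost everywhere, so the choice below does not affect integrals.
\<close>

definition second_deriv :: "(real \<Rightarrow> real) \<Rightarrow> real \<Rightarrow> real" where
  "second_deriv g = (SOME h. ac_density (first_deriv g) h)"

text \<open>
  The second derivative of a member of the class is integrable but need not be square integrable.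
  The criterion is therefore valued in \<^typ>\<open>ennreal\<close>; a Bochner integral would assign
  the value 0 to a divergent penalty.
\<close>

definition criterion ::
  "real^'n \<Rightarrow> real^'n \<Rightarrow> real^'p^'n \<Rightarrow> (real^'p) measure \<Rightarrow> real \<Rightarrow> (real \<Rightarrow> real) \<Rightarrow> ennreal" where
  "criterion Y Z W \<mu> lam g =
     (\<integral>\<^sup>+ t. ennreal ((cmod (1 / of_nat CARD('n) *
          (\<Sum>i\<in>UNIV. of_real (Y $ i - g (Z $ i)) * exp (\<i> * of_real (W $ i \<bullet> t)))))\<^sup>2) \<partial>\<mu>)
     + ennreal lam * (\<integral>\<^sup>+ z\<in>{0..1}. ennreal (\<bar>second_deriv g z\<bar>\<^sup>2) \<partial>lborel)"


section \<open>Assumptions on the measure\<close>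

definition symmetric_measure :: "'a::real_normed_vector measure \<Rightarrow> bool" where
  "symmetric_measure \<mu> \<longleftrightarrow> distr \<mu> \<mu> uminus = \<mu>"

definition measure_support :: "'a::topological_space measure \<Rightarrow> 'a set" where
  "measure_support \<mu> = {x. \<forall>U. open U \<and> x \<in> U \<longrightarrow> emeasure \<mu> U > 0}"

definition omega :: "(real^'p) measure \<Rightarrow> real^'p \<Rightarrow> real" where
  "omega \<mu> w = (LINT t|\<mu>. cos (t \<bullet> w))"


section \<open>Natural cubic splines\<close>

definition natural_cubic_spline :: "real set \<Rightarrow> (real \<Rightarrow> real) \<Rightarrow> bool" where
  "natural_cubic_spline K s \<longleftrightarrow>
     (\<forall>a\<in>K. \<forall>b\<in>K. a < b \<and> {a<..<b} \<inter> K = {} \<longrightarrow>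
        (\<exists>p. degree p \<le> 3 \<and> (\<forall>x\<in>{a..b}. s x = poly p x))) \<and>
     (\<exists>s' s''. (\<forall>x. (s has_real_derivative s' x) (at x)) \<and>
               (\<forall>x. (s' has_real_derivative s'' x) (at x)) \<and>
               continuous_on UNIV s'') \<and>
     (\<exists>c d. \<forall>x<Min K. s x = c + d * x) \<and>
     (\<exists>c d. \<forall>x>Max K. s x = c + d * x)"


section \<open>Matrices\<close>

definition Z_mat :: "real^'n \<Rightarrow> real^2^'n" where
  "Z_mat Z = (\<chi> i. vector [1, Z $ i])"

definition E_mat :: "real^'n \<Rightarrow> real^'n^'n" where
  "E_mat Z = (\<chi> i j. \<bar>Z $ i - Z $ j\<bar> ^ 3 / 12)"

definition Omega_mat :: "(real^'p) measure \<Rightarrow> real^'p^'n \<Rightarrow> real^'n^'n" where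
  "Omega_mat \<mu> W = (\<chi> i j. omega \<mu> (W $ i - W $ j) / (real CARD('n))\<^sup>2)"

definition E_tilde :: "real^'n \<Rightarrow> real^'p^'n \<Rightarrow> (real^'p) measure \<Rightarrow> real \<Rightarrow> real^'n^'n" where
  "E_tilde Z W \<mu> lam = E_mat Z + lam *\<^sub>R matrix_inv (Omega_mat \<mu> W)"

definition P_mat :: "real^'n \<Rightarrow> real^'p^'n \<Rightarrow> (real^'p) measure \<Rightarrow> real \<Rightarrow> real^'n^'n" where
  "P_mat Z W \<mu> lam =
     Z_mat Z ** matrix_inv (transpose (Z_mat Z) ** matrix_inv (E_tilde Z W \<mu> lam) ** Z_mat Z)
       ** transpose (Z_mat Z) ** matrix_inv (E_tilde Z W \<mu> lam)"

definition block_vector :: "'a^'m \<Rightarrow> 'a^'n \<Rightarrow> 'a^('m + 'n)" where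
  "block_vector u v = (\<chi> i. case i of Inl k \<Rightarrow> u $ k | Inr k \<Rightarrow> v $ k)"

text \<open>The blocks are listed row by row.\<close>

definition block_matrix ::
  "'a^'m^'k \<Rightarrow> 'a^'n^'k \<Rightarrow> 'a^'m^'l \<Rightarrow> 'a^'n^'l \<Rightarrow> 'a^('m + 'n)^('k + 'l)" where
  "block_matrix A B C D =
     (\<chi> i. case i of Inl k \<Rightarrow> block_vector (A $ k) (B $ k) | Inr k \<Rightarrow> block_vector (C $ k) (D $ k))"

definition spline_system ::
  "real^'n \<Rightarrow> real^'n \<Rightarrow> real^'p^'n \<Rightarrow> (real^'p) measure \<Rightarrow> real \<Rightarrow> real^'n \<Rightarrow> real^2 \<Rightarrow> bool" where
  "spline_system Y Z W \<mu> lam \<delta> a \<longleftrightarrow>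
     block_matrix (E_tilde Z W \<mu> lam) (Z_mat Z) (transpose (Z_mat Z)) 0 *v block_vector \<delta> a
       = block_vector Y 0"

end

theory Submission
  imports Defs
begin

text \<open>
  Write \<open>s\<close> for the candidate spline and \<open>S = s''\<close>. Because the coefficients \<open>\<delta>\<close> annihilate affine
  functions, \<open>S(t) = \<Sum>\<^sub>i \<delta>\<^sub>i max 0 (Z\<^sub>i - t)\<close>, so Taylor's formula with integral remainder gives
  \<open>\<integral> S h'' = \<Sum>\<^sub>i \<delta>\<^sub>i h(Z\<^sub>i)\<close> for every \<open>h\<close> in the class. The linear system says precisely that
  \<open>\<Omega>\<close> maps the residual \<open>Y - s(Z)\<close> to \<open>\<lambda> \<delta>\<close>, so that the cross terms of the criterion cancel:
  with \<open>h = g - s\<close>, the criterion at \<open>g\<close> equals its value at \<open>s\<close> plus \<open>h(Z)\<^sup>T \<Omega> h(Z) + \<lambda> \<integral> (h'')\<^sup>2\<close>.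
  Positive definiteness of \<open>\<Omega>\<close>, which rests on the linear independence of the characters
  \<open>t \<mapsto> exp(\<i> W\<^sub>k\<^sup>T t)\<close> and the full support of \<open>\<mu>\<close>, then yields uniqueness.
\<close>

section \<open>Positive definiteness of the matrix \<open>\<Omega>\<close>\<close>

text \<open>Dedekind's argument: comparing the relation at \<open>t + u\<close> with \<open>f k u\<close> times the relation at
  \<open>t\<close> eliminates the character \<open>f k\<close>.\<close>

lemma characters_independent:
  fixes f :: "'i \<Rightarrow> 'a::ab_group_add \<Rightarrow> 'b::idom" and c :: "'i \<Rightarrow> 'b"
  assumes "finite A"
    and mult: "\<And>i t u. f i (t + u) = f i t * f i u"
    and one: "\<And>i. f i 0 = 1"
    and inj: "inj_on f A"
    and rel: "\<And>t. (\<Sum>i\<in>A. c i * f i t) = 0"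
  shows "\<forall>i\<in>A. c i = 0"
  using \<open>finite A\<close> inj rel
proof (induction A arbitrary: c)
  case (insert k A)
  have "c i = 0" if i: "i \<in> A" for i
  proof -
    have "f i \<noteq> f k"
      using insert.prems(1) insert.hyps i by (auto simp: inj_on_def)
    then obtain u where u: "f i u \<noteq> f k u"
      by auto
    have "(\<Sum>j\<in>A. (c j * (f j u - f k u)) * f j t) = 0" for t
    proof -
      have "(\<Sum>j\<in>insert k A. c j * f j (t + u)) - f k u * (\<Sum>j\<in>insert k A. c j * f j t)
          = (\<Sum>j\<in>insert k A. (c j * (f j u - f k u)) * f j t)"
        by (simp add: mult sum_distrib_left sum_subtractf[symmetric] algebra_simps del: sum.insert)
      then show ?thesis
        using insert.prems(2)[of t] insert.prems(2)[of "t + u"] insert.hyps by simp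
    qed
    from insert.IH[OF _ this] insert.prems(1) i have "c i * (f i u - f k u) = 0"
      by auto
    with u show ?thesis
      by simp
  qed
  moreover have "c k = 0"
    using insert.prems(2)[of 0] calculation insert.hyps by (simp add: one)
  ultimately show ?case
    by auto
qed simp

lemma inj_exp_inner: "inj (\<lambda>(w::'a::real_inner) t. exp (\<i> * complex_of_real (w \<bullet> t)))"
proof (rule injI, rule ccontr)
  fix v w :: 'a
  assume eq: "(\<lambda>t. exp (\<i> * complex_of_real (v \<bullet> t))) = (\<lambda>t. exp (\<i> * complex_of_real (w \<bullet> t)))"
    and "v \<noteq> w"
  \<comment> \<open>Scaled so that its inner product with \<open>v - w\<close> is \<open>pi\<close>;
    there the two characters differ by the factor -1.\<close>
  define t where "t = (pi / ((v - w) \<bullet> (v - w))) *\<^sub>R (v - w)"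
  have "(v - w) \<bullet> t = pi"
    using \<open>v \<noteq> w\<close> by (simp add: t_def)
  then have vt: "v \<bullet> t = w \<bullet> t + pi"
    by (simp add: inner_diff_left)
  have "exp (\<i> * complex_of_real (v \<bullet> t)) = - exp (\<i> * complex_of_real (w \<bullet> t))"
    by (simp add: vt distrib_left exp_add exp_pi_i')
  with fun_cong[OF eq, of t] show False
    by simp
qed

text \<open>Distinct frequencies give distinct characters of the additive group, so Dedekind
  independence applies.\<close>

lemma trig_sum_eq_0_imp:
  fixes r :: "real^'n" and W :: "real^'p^'n"
  assumes inj: "inj (\<lambda>i. W $ i)"
    and rel: "\<And>t. (\<Sum>i\<in>UNIV. complex_of_real (r $ i) * exp (\<i> * of_real (W $ i \<bullet> t))) = 0"
  shows "r = 0"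
proof -
  have "\<forall>i\<in>UNIV. complex_of_real (r $ i) = 0"
  proof (rule characters_independent)
    show "inj_on (\<lambda>i t. exp (\<i> * complex_of_real (W $ i \<bullet> t))) UNIV"
      using inj_compose[OF inj_exp_inner inj] by (simp add: o_def)
  qed (use rel in \<open>auto simp: inner_add_right distrib_left exp_add\<close>)
  then show ?thesis
    by (simp add: vec_eq_iff)
qed

text \<open>The coefficients are real, so the squares of real and imaginary part add up to cosines
  of differences only. This is how \<open>omega\<close> becomes a cosine transform.\<close>

lemma cmod_trig_sum_squared:
  fixes r :: "real^'n" and W :: "real^'p^'n"
  shows "(cmod (\<Sum>i\<in>UNIV. of_real (r $ i) * exp (\<i> * of_real (W $ i \<bullet> t))))\<^sup>2
     = (\<Sum>i\<in>UNIV. \<Sum>j\<in>UNIV. r $ i * r $ j * cos (t \<bullet> (W $ i - W $ j)))"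
proof -
  define s where "s = (\<Sum>i\<in>UNIV. of_real (r $ i) * exp (\<i> * complex_of_real (W $ i \<bullet> t)))"
  have Re: "Re s = (\<Sum>i\<in>UNIV. r $ i * cos (W $ i \<bullet> t))"
    and Im: "Im s = (\<Sum>i\<in>UNIV. r $ i * sin (W $ i \<bullet> t))"
    by (auto simp: s_def Re_exp Im_exp)
  have "(cmod s)\<^sup>2 = (\<Sum>i\<in>UNIV. \<Sum>j\<in>UNIV.
      (r $ i * cos (W $ i \<bullet> t)) * (r $ j * cos (W $ j \<bullet> t))
      + (r $ i * sin (W $ i \<bullet> t)) * (r $ j * sin (W $ j \<bullet> t)))"
    by (simp only: cmod_power2 Re Im power2_eq_square[of "sum _ _"] sum_product sum.distrib)
  also have "\<dots> = (\<Sum>i\<in>UNIV. \<Sum>j\<in>UNIV. r $ i * r $ j * cos (t \<bullet> (W $ i - W $ j)))"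
    by (intro sum.cong refl)
      (simp add: inner_diff_right cos_diff inner_commute[of t] algebra_simps)
  finally show ?thesis
    by (simp add: s_def)
qed

lemma quadratic_form_eq:
  fixes A :: "real^'n^'n"
  shows "x \<bullet> (A *v x) = (\<Sum>i\<in>UNIV. \<Sum>j\<in>UNIV. x $ i * x $ j * A $ i $ j)"
  by (simp add: inner_vec_def matrix_vector_mult_def sum_distrib_left mult_ac)

text \<open>Turns the data term of the criterion into a quadratic form in the residual; squaring the
  factor 1/n gives the scaling in \<open>Omega_mat\<close>.\<close>

lemma Omega_quadratic_form:
  fixes r :: "real^'n" and W :: "real^'p^'n"
  assumes "prob_space \<mu>" and sets [measurable_cong]: "sets \<mu> = sets borel"
  defines "q \<equiv> \<lambda>t. (cmod (1 / of_nat CARD('n) *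
          (\<Sum>i\<in>UNIV. of_real (r $ i) * exp (\<i> * of_real (W $ i \<bullet> t)))))\<^sup>2"
  shows "integrable \<mu> q" and "(LINT t|\<mu>. q t) = r \<bullet> (Omega_mat \<mu> W *v r)"
proof -
  interpret prob_space \<mu> by fact
  let ?n = "real CARD('n)"
  have int: "integrable \<mu> (\<lambda>t. cos (t \<bullet> w))" for w :: "real^'p"
    by (rule integrable_const_bound[of _ 1]) auto
  have q: "q = (\<lambda>t. \<Sum>i\<in>UNIV. \<Sum>j\<in>UNIV. r $ i * r $ j * (cos (t \<bullet> (W $ i - W $ j)) / ?n\<^sup>2))"
    unfolding q_def norm_mult power_mult_distrib cmod_trig_sum_squared
    by (simp add: norm_divide power_divide sum_divide_distrib)
  show "integrable \<mu> q" "(LINT t|\<mu>. q t) = r \<bullet> (Omega_mat \<mu> W *v r)"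
    using int by (simp_all add: q quadratic_form_eq Omega_mat_def omega_def)
qed

lemma nn_integral_trig_sum:
  fixes r :: "real^'n" and W :: "real^'p^'n"
  assumes "prob_space \<mu>" and "sets \<mu> = sets borel"
  shows "(\<integral>\<^sup>+ t. ennreal ((cmod (1 / of_nat CARD('n) *
          (\<Sum>i\<in>UNIV. of_real (r $ i) * exp (\<i> * of_real (W $ i \<bullet> t)))))\<^sup>2) \<partial>\<mu>)
     = ennreal (r \<bullet> (Omega_mat \<mu> W *v r))"
  unfolding Omega_quadratic_form(2)[OF assms, symmetric]
  by (rule nn_integral_eq_integral[OF Omega_quadratic_form(1)[OF assms]]) simp

lemma Omega_nonneg:
  fixes r :: "real^'n" and W :: "real^'p^'n"
  assumes "prob_space \<mu>" and "sets \<mu> = sets borel"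
  shows "0 \<le> r \<bullet> (Omega_mat \<mu> W *v r)"
  unfolding Omega_quadratic_form(2)[OF assms, symmetric] by (rule Bochner_Integration.integral_nonneg) simp

lemma Omega_sym: "transpose (Omega_mat \<mu> W) = Omega_mat \<mu> W"
proof -
  have "cos (t \<bullet> (v - w)) = cos (t \<bullet> (w - v))" for t v w :: "real^'p"
    using cos_minus[of "t \<bullet> (v - w)"] by (simp add: inner_diff_right)
  then have "omega \<mu> (W $ j - W $ i) = omega \<mu> (W $ i - W $ j)" for i j
    unfolding omega_def by (intro Bochner_Integration.integral_cong refl)
  then show ?thesis
    by (simp add: Omega_mat_def transpose_def vec_eq_iff)
qed

text \<open>The set where \<open>f\<close> differs from \<open>c\<close> is open; if it had a point,
  full support would give it positive measure.\<close>

lemma continuous_zero_if_AE_zero: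
  fixes f :: "'a::topological_space \<Rightarrow> 'b::t1_space"
  assumes "sets \<mu> = sets borel" and supp: "measure_support \<mu> = UNIV"
    and f: "continuous_on UNIV f" and AE: "AE t in \<mu>. f t = c"
  shows "f t = c"
proof (rule ccontr)
  assume t: "f t \<noteq> c"
  let ?U = "f -` (- {c})"
  have "open ?U"
    by (rule open_vimage[OF _ f]) auto
  moreover have "t \<in> ?U"
    using t by simp
  ultimately have "emeasure \<mu> ?U > 0"
    using supp by (auto simp: measure_support_def)
  moreover have "?U \<in> null_sets \<mu>"
    using \<open>open ?U\<close> AE assms(1) sets_eq_imp_space_eq[OF assms(1)]
    by (subst AE_iff_null_sets) (auto elim!: eventually_mono)
  ultimately show False
    by auto
qed

text \<open>A zero of the form makes the trigonometric sum vanish almost everywhere, then everywhere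
  by continuity and full support, and the independence of the characters applies.\<close>

lemma Omega_pos_def:
  fixes r :: "real^'n" and W :: "real^'p^'n"
  assumes "prob_space \<mu>" and sets [measurable_cong]: "sets \<mu> = sets borel"
    and supp: "measure_support \<mu> = UNIV" and inj: "inj (\<lambda>i. W $ i)"
    and zero: "r \<bullet> (Omega_mat \<mu> W *v r) = 0"
  shows "r = 0"
proof (rule trig_sum_eq_0_imp[OF inj])
  let ?s = "\<lambda>t. \<Sum>i\<in>UNIV. complex_of_real (r $ i) * exp (\<i> * of_real (W $ i \<bullet> t))"
  have cont: "continuous_on UNIV ?s"
    by (intro continuous_intros)
  then have [measurable]: "?s \<in> borel_measurable borel"
    by (rule borel_measurable_continuous_onI)
  have "(\<integral>\<^sup>+ t. ennreal ((cmod (1 / of_nat CARD('n) * ?s t))\<^sup>2) \<partial>\<mu>) = 0"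
    by (simp only: nn_integral_trig_sum[OF assms(1,2)] zero ennreal_0)
  then have "AE t in \<mu>. ?s t = 0"
    by (subst (asm) nn_integral_0_iff_AE) (auto simp: norm_mult)
  from continuous_zero_if_AE_zero[OF sets supp cont this] show "?s t = 0" for t .
qed

section \<open>Absolutely continuous derivatives\<close>

text \<open>The positive and negative parts of \<open>k\<close> are densities of two measures that
  are finite and equal on all right half-lines. Hence the measures coincide, and so do the densities
  almost everywhere.\<close>

lemma AE_zero_if_tail_integrals_zero:
  fixes k :: "real \<Rightarrow> real"
  assumes k [measurable]: "integrable lborel k"
    and tail: "\<And>a. (LINT t:{a<..}|lborel. k t) = 0"
  shows "AE t in lborel. k t = 0"
proof -
  \<comment> \<open>\<open>ennreal\<close> sends negative reals to 0, so \<open>M\<close> and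
    \<open>N\<close> belong to the positive and the negative part of \<open>k\<close>.\<close>
  define M where "M = density lborel (\<lambda>t. ennreal (k t))"
  define N where "N = density lborel (\<lambda>t. ennreal (- k t))"
  have eM: "emeasure M {a<..} = (\<integral>\<^sup>+t. ennreal (indicator {a<..} t * k t) \<partial>lborel)" for a
    unfolding M_def by (subst emeasure_density) (auto intro!: nn_integral_cong simp: indicator_def)
  have eN: "emeasure N {a<..} = (\<integral>\<^sup>+t. ennreal (- (indicator {a<..} t * k t)) \<partial>lborel)" for a
    unfolding N_def by (subst emeasure_density) (auto intro!: nn_integral_cong simp: indicator_def)
  have int: "integrable lborel (\<lambda>t. indicator {a<..} t * k t)" for a
    using integrable_mult_indicator[OF _ k, of "{a<..}"] by simp
  have fin: "emeasure M {a<..} < \<infinity>" "emeasure N {a<..} < \<infinity>" for a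
    using int[of a] by (auto simp: eM eN less_top real_integrable_def)
  have eq: "emeasure M {a<..} = emeasure N {a<..}" for a
  proof -
    have "enn2real (emeasure M {a<..}) - enn2real (emeasure N {a<..}) = 0"
      using tail[of a] real_lebesgue_integral_def[OF int[of a]]
      by (simp add: set_lebesgue_integral_def eM eN)
    then show ?thesis
      using fin[of a] by (metis ennreal_enn2real eq_iff_diff_eq_0 infinity_ennreal_def)
  qed
  have "M = N"
    by (rule measure_eqI_lessThan) (use fin eq in \<open>auto simp: M_def N_def\<close>)
  then have "AE t in lborel. ennreal (k t) = ennreal (- k t)"
    unfolding M_def N_def
    by (subst (asm) sigma_finite_measure.density_unique_iff[OF lborel.sigma_finite_measure_axioms]) auto
  \<comment> \<open>At least one of \<open>k t\<close> and \<open>- k t\<close> is sent to 0, so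
    equality forces \<open>k t = 0\<close>.\<close>
  then show ?thesis
    by eventually_elim (smt (verit) ennreal_eq_0_iff)
qed

text \<open>This uniqueness makes the arbitrary choice in \<open>second_deriv\<close> harmless. Both
  densities have the same integral over every \<open>{0..z}\<close>, so their difference, cut off to
  the unit interval, has vanishing tail integrals.\<close>

lemma ac_density_AE_eq:
  assumes "ac_density f h" and "ac_density f k"
  shows "AE t in lborel. t \<in> {0..1} \<longrightarrow> h t = k t"
proof -
  define d where "d = (\<lambda>t. indicator {0..1} t * (h t - k t))"
  have hi: "set_integrable lborel {0..1} h" and ki: "set_integrable lborel {0..1} k"
    using assms by (auto simp: ac_density_def)
  have di: "integrable lborel d"
    using set_integral_diff(1)[OF hi ki] by (simp add: d_def set_integrable_def)
  have head: "(LINT t:{0..z}|lborel. h t - k t) = 0" if "z \<in> {0..1}" for z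
  proof -
    have "set_integrable lborel {0..z} h" "set_integrable lborel {0..z} k"
      using that set_integrable_subset[OF hi, of "{0..z}"] set_integrable_subset[OF ki, of "{0..z}"] by auto
    then show ?thesis
      using assms that by (simp add: set_integral_diff ac_density_def)
  qed
  have tail: "(LINT t:{a<..}|lborel. d t) = 0" for a
  proof -
    \<comment> \<open>Clamping \<open>a\<close> to the unit interval writes the tail as the full
      integral minus the one over \<open>{0..b}\<close>.\<close>
    define b where "b = max 0 (min 1 a)"
    have b: "b \<in> {0..1}" by (auto simp: b_def)
    have i1: "integrable lborel (\<lambda>t. indicator {0..b} t * (h t - k t))"
      using b set_integrable_subset[OF set_integral_diff(1)[OF hi ki], of "{0..b}"]
      by (simp add: set_integrable_def)
    have "(LINT t:{a<..}|lborel. d t) =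
        (LINT t|lborel. indicator {0..1} t * (h t - k t) - indicator {0..b} t * (h t - k t))"
      unfolding set_lebesgue_integral_def
    proof (rule integral_cong_AE)
      show "AE t in lborel. indicator {a<..} t *\<^sub>R d t
          = indicator {0..1} t * (h t - k t) - indicator {0..b} t * (h t - k t)"
        \<comment> \<open>For \<open>a < 0\<close> the set \<open>{0..b}\<close> is the single point
          0, where the two integrands may differ; it is a null set.\<close>
        using AE_lborel_singleton[of 0]
        by eventually_elim (auto simp: d_def b_def indicator_def)
    qed (use di i1 in \<open>auto simp: d_def\<close>)
    also have "\<dots> = (LINT t:{0..1}|lborel. h t - k t) - (LINT t:{0..b}|lborel. h t - k t)"
      using di i1 by (simp add: set_lebesgue_integral_def d_def)
    finally show ?thesis
      using head[OF b] head[of 1] by simp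
  qed
  from AE_zero_if_tail_integrals_zero[OF di tail]
  show ?thesis
    by eventually_elim (auto simp: d_def)
qed

text \<open>Integrating \<open>g'\<close> and inserting its density gives a double integral over the
  triangle \<open>0 \<le> t \<le> u \<le> x\<close>. By Fubini, integrating over \<open>u\<close>
  first produces the weight \<open>x - t\<close>.\<close>

lemma ac_taylor:
  assumes g: "\<And>z. z \<in> {0..1} \<Longrightarrow> (g has_vector_derivative g' z) (at z within {0..1})"
    and ac: "ac_density g' h" and x: "x \<in> {0..1}"
  shows "g x = g 0 + g' 0 * x + (LINT t:{0..x}|lborel. (x - t) * h t)"
proof -
  define k where "k = (\<lambda>t. indicator {0..x} t * h t)"
  have ki: "integrable lborel k"
    using ac set_integrable_subset[of lborel "{0..1}" h "{0..x}"] x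
    by (auto simp: ac_density_def set_integrable_def k_def)
  have [measurable]: "k \<in> borel_measurable borel"
    using borel_measurable_integrable[OF ki] by simp
  define f where "f = (\<lambda>(u::real, t::real). if t \<le> u \<and> 0 \<le> u \<and> u \<le> x then k t else 0)"
  have [measurable]: "f \<in> borel_measurable (lborel \<Otimes>\<^sub>M lborel)"
    unfolding f_def by measurable
  have row: "integrable lborel (\<lambda>t. f (u, t))" for u
    by (rule Bochner_Integration.integrable_bound[OF ki]) (auto simp: f_def)
  have fi: "integrable (lborel \<Otimes>\<^sub>M lborel) f"
  proof (rule lborel_pair.Fubini_integrable)
    show "integrable lborel (\<lambda>u. \<integral>t. norm (f (u, t)) \<partial>lborel)"
    proof (rule Bochner_Integration.integrable_bound)
      show "integrable lborel (\<lambda>u. indicator {0..x} u * (\<integral>t. norm (k t) \<partial>lborel))"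
        using x by (auto intro!: integrable_mult_left integrable_real_indicator)
      show "AE u in lborel. norm (\<integral>t. norm (f (u, t)) \<partial>lborel)
          \<le> norm (indicator {0..x} u * (\<integral>t. norm (k t) \<partial>lborel))"
      proof (rule AE_I2)
        fix u
        have "(\<integral>t. norm (f (u, t)) \<partial>lborel) \<le> (\<integral>t. indicator {0..x} u * norm (k t) \<partial>lborel)"
          by (rule integral_mono) (use row ki in \<open>auto simp: f_def\<close>)
        then show "norm (\<integral>t. norm (f (u, t)) \<partial>lborel)
          \<le> norm (indicator {0..x} u * (\<integral>t. norm (k t) \<partial>lborel))"
          by simp
      qed
    qed measurable
  qed (use row in auto)
  have inner: "(\<integral>t. f (u, t) \<partial>lborel) = indicator {0..x} u * (g' u - g' 0)" for u
  proof (cases "u \<in> {0..x}")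
    case True
    then have "(\<integral>t. f (u, t) \<partial>lborel) = (LINT t:{0..u}|lborel. h t)"
      unfolding set_lebesgue_integral_def
      by (intro Bochner_Integration.integral_cong) (auto simp: f_def k_def indicator_def)
    also have "\<dots> = g' u - g' 0"
      using ac True x by (auto simp: ac_density_def)
    finally show ?thesis
      using True by simp
  qed (auto simp: f_def)
  have outer: "(\<integral>u. f (u, t) \<partial>lborel) = indicator {0..x} t * ((x - t) * h t)" for t
  proof -
    have "(\<integral>u. f (u, t) \<partial>lborel) = (\<integral>u. indicator {t..x} u * k t \<partial>lborel)"
      by (intro Bochner_Integration.integral_cong) (auto simp: f_def k_def indicator_def)
    then show ?thesis
      by (cases "t \<le> x") (auto simp: k_def)
  qed
  have "integrable lborel (\<lambda>u. indicator {0..x} u * (g' u - g' 0))"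
    using lborel_pair.integrable_fst'[OF fi] by (simp add: inner)
  then have "set_integrable lborel {0..x} (\<lambda>u. g' u - g' 0)"
    by (simp add: set_integrable_def)
  from set_borel_integral_eq_integral(2)[OF this]
  have leb: "(\<integral>u. (\<integral>t. f (u, t) \<partial>lborel) \<partial>lborel) = integral {0..x} (\<lambda>u. g' u - g' 0)"
    by (simp add: inner set_lebesgue_integral_def)
  \<comment> \<open>The fundamental theorem of calculus concerns the gauge integral;
    \<open>leb\<close> identifies that integral with the iterated Lebesgue integral.\<close>
  have "(g has_vector_derivative g' u) (at u within {0..x})" if "u \<in> {0..x}" for u
    using g[of u] that x by (auto intro: has_vector_derivative_within_subset)
  then have "(g' has_integral (g x - g 0)) {0..x}"
    using x by (intro fundamental_theorem_of_calculus) auto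
  then have "((\<lambda>u. g' u - g' 0) has_integral (g x - g 0 - x * g' 0)) {0..x}"
    using has_integral_diff[OF _ has_integral_const_real[of "g' 0" 0 x]] x by fastforce
  then have "g x - g 0 - x * g' 0 = (\<integral>u. (\<integral>t. f (u, t) \<partial>lborel) \<partial>lborel)"
    using leb by (simp add: integral_unique)
  also have "\<dots> = (\<integral>t. (\<integral>u. f (u, t) \<partial>lborel) \<partial>lborel)"
    using lborel_pair.Fubini_integral[of "\<lambda>u t. f (u, t)"] fi by simp
  also have "\<dots> = (LINT t:{0..x}|lborel. (x - t) * h t)"
    by (simp add: outer set_lebesgue_integral_def)
  finally show ?thesis
    by (simp add: algebra_simps)
qed

section \<open>Splines with given knots\<close>

text \<open>The second derivative of \<open>spline_fun\<close>: differentiating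
  \<open>\<bar>z - c\<bar> ^ 3 / 12\<close> twice gives
  \<open>\<bar>z - c\<bar> / 2\<close>.\<close>

definition spline_curv :: "real^'n \<Rightarrow> real^'n \<Rightarrow> real \<Rightarrow> real" where
  "spline_curv Z \<delta> z = (\<Sum>i\<in>UNIV. \<delta> $ i * \<bar>z - Z $ i\<bar>) / 2"

definition spline_fun :: "real^'n \<Rightarrow> real^'n \<Rightarrow> real^2 \<Rightarrow> real \<Rightarrow> real" where
  "spline_fun Z \<delta> a z = a $ 1 + a $ 2 * z + 1 / 12 * (\<Sum>i\<in>UNIV. \<delta> $ i * \<bar>z - Z $ i\<bar> ^ 3)"

definition spline_slope :: "real^'n \<Rightarrow> real^'n \<Rightarrow> real^2 \<Rightarrow> real \<Rightarrow> real" where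
  "spline_slope Z \<delta> a z = a $ 2 + (\<Sum>i\<in>UNIV. \<delta> $ i * ((z - Z $ i) * \<bar>z - Z $ i\<bar>)) / 4"

lemma continuous_on_spline_curv [continuous_intros]: "continuous_on A (spline_curv Z \<delta>)"
  unfolding spline_curv_def by (intro continuous_intros) auto

lemma borel_measurable_spline_curv [measurable]: "spline_curv Z \<delta> \<in> borel_measurable borel"
  by (intro borel_measurable_continuous_onI continuous_intros)

lemma set_integrable_spline_curv_power2: "set_integrable lborel {a..b} (\<lambda>t. (spline_curv Z \<delta> t)\<^sup>2)"
  unfolding set_integrable_def by (intro borel_integrable_compact continuous_intros) auto

section \<open>Derivatives of the spline\<close>

text \<open>At 0 the difference quotient is \<open>\<bar>h\<bar>\<close>; elsewhere the function
  agrees near \<open>x\<close> with a signed square.\<close>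

lemma has_real_derivative_self_abs:
  "((\<lambda>x::real. x * \<bar>x\<bar>) has_real_derivative 2 * \<bar>x\<bar>) (at x)"
proof (cases "x = 0")
  case True
  have "((\<lambda>h::real. \<bar>h\<bar>) \<longlongrightarrow> \<bar>0\<bar>) (at 0)"
    by (intro tendsto_intros)
  then have "((\<lambda>h::real. h * \<bar>h\<bar> / h) \<longlongrightarrow> \<bar>0\<bar>) (at 0)"
    by (rule Lim_transform_eventually) (auto simp: eventually_at_filter)
  with True show ?thesis
    by (simp add: DERIV_def)
next
  case False
  have d: "((\<lambda>y. sgn x * (y * y)) has_real_derivative 2 * \<bar>x\<bar>) (at x)"
    by (auto intro!: derivative_eq_intros simp: sgn_if)
  have eq: "sgn x * (y * y) = y * \<bar>y\<bar>" if "y \<in> (if x < 0 then {..<0} else {0<..})" for y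
    using that False by (auto simp: sgn_if split: if_splits)
  show ?thesis
    by (rule has_field_derivative_transform_within_open[OF d _ _ eq]) (use False in auto)
qed

lemma has_real_derivative_abs_cube:
  "((\<lambda>x::real. \<bar>x\<bar> ^ 3) has_real_derivative 3 * (x * \<bar>x\<bar>)) (at x)"
proof -
  have "((\<lambda>x::real. x * (x * \<bar>x\<bar>)) has_real_derivative 3 * (x * \<bar>x\<bar>)) (at x)"
    by (rule derivative_eq_intros has_real_derivative_self_abs refl)+ simp
  moreover have "(\<lambda>x::real. x * (x * \<bar>x\<bar>)) = (\<lambda>x. \<bar>x\<bar> ^ 3)"
    by (auto simp: fun_eq_iff abs_if power3_eq_cube)
  ultimately show ?thesis
    by simp
qed

lemma spline_fun_deriv:
  "(spline_fun Z \<delta> a has_real_derivative spline_slope Z \<delta> a z) (at z)"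
proof -
  have "((\<lambda>z. \<bar>z - c\<bar> ^ 3) has_real_derivative 3 * ((z - c) * \<bar>z - c\<bar>)) (at z)" for c
  proof -
    have "((\<lambda>z. z - c) has_real_derivative 1) (at z)"
      by (auto intro!: derivative_eq_intros)
    from DERIV_chain2[OF has_real_derivative_abs_cube this] show ?thesis
      by simp
  qed
  then have "((\<lambda>z. \<Sum>i\<in>UNIV. \<delta> $ i * \<bar>z - Z $ i\<bar> ^ 3) has_real_derivative
      (\<Sum>i\<in>UNIV. \<delta> $ i * (3 * ((z - Z $ i) * \<bar>z - Z $ i\<bar>)))) (at z)"
    by (intro DERIV_sum DERIV_cmult)
  also have "(\<Sum>i\<in>UNIV. \<delta> $ i * (3 * ((z - Z $ i) * \<bar>z - Z $ i\<bar>)))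
      = 3 * (\<Sum>i\<in>UNIV. \<delta> $ i * ((z - Z $ i) * \<bar>z - Z $ i\<bar>))"
    by (simp add: sum_distrib_left mult_ac)
  finally show ?thesis
    unfolding spline_fun_def spline_slope_def
    using DERIV_add[OF DERIV_add[OF DERIV_const DERIV_cmult[OF DERIV_ident]] DERIV_cmult,
        of _ _ z UNIV "a $ 1" "a $ 2" "1 / 12"] by fastforce
qed

lemma spline_slope_deriv:
  "(spline_slope Z \<delta> a has_real_derivative spline_curv Z \<delta> z) (at z)"
proof -
  have "((\<lambda>z. (z - c) * \<bar>z - c\<bar>) has_real_derivative 2 * \<bar>z - c\<bar>) (at z)" for c
  proof -
    have "((\<lambda>z. z - c) has_real_derivative 1) (at z)"
      by (auto intro!: derivative_eq_intros)
    from DERIV_chain2[OF has_real_derivative_self_abs this] show ?thesis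
      by simp
  qed
  then have "((\<lambda>z. \<Sum>i\<in>UNIV. \<delta> $ i * ((z - Z $ i) * \<bar>z - Z $ i\<bar>)) has_real_derivative
      (\<Sum>i\<in>UNIV. \<delta> $ i * (2 * \<bar>z - Z $ i\<bar>))) (at z)"
    by (intro DERIV_sum DERIV_cmult)
  also have "(\<Sum>i\<in>UNIV. \<delta> $ i * (2 * \<bar>z - Z $ i\<bar>)) = 2 * (\<Sum>i\<in>UNIV. \<delta> $ i * \<bar>z - Z $ i\<bar>)"
    by (simp add: sum_distrib_left mult_ac)
  finally show ?thesis
    unfolding spline_slope_def spline_curv_def
    using DERIV_add[OF DERIV_const DERIV_cdivide, of _ _ z UNIV "a $ 2" 4] by fastforce
qed

text \<open>Here \<open>f'\<close> is a copy of \<open>f\<close>, required to agree with it only on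
  the unit interval, which is all that is known about \<open>first_deriv\<close> of a restricted
  function.\<close>

lemma ac_densityI_deriv:
  assumes "\<And>z. (f has_real_derivative h z) (at z)" and "continuous_on {0..1} h"
    and "\<And>z. z \<in> {0..1} \<Longrightarrow> f' z = f z"
  shows "ac_density f' h"
  unfolding ac_density_def
proof (intro conjI ballI)
  show si: "set_integrable lborel {0..1} h"
    unfolding set_integrable_def by (rule borel_integrable_compact) (use assms in auto)
  fix z :: real assume z: "z \<in> {0..1}"
  have "set_integrable lborel {0..z} h"
    using set_integrable_subset[OF si, of "{0..z}"] z by auto
  from set_borel_integral_eq_integral(2)[OF this]
  have "(LINT t:{0..z}|lborel. h t) = integral {0..z} h" .
  moreover have "(h has_integral (f z - f 0)) {0..z}"
    using z assms(1)
    by (intro fundamental_theorem_of_calculus)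
      (auto simp: has_real_derivative_iff_has_vector_derivative intro: has_vector_derivative_at_within)
  ultimately show "f' z - f' 0 = (LINT t:{0..z}|lborel. h t)"
    using assms(3) z by (simp add: integral_unique)
qed

section \<open>Pairing the curvature with second derivatives\<close>

text \<open>Pointwise, \<open>\<bar>t - z\<bar> = 2 * max 0 (z - t) + (t - z)\<close>, and the
  affine part sums to zero against \<open>\<delta>\<close>. What remains is a combination of the
  kernels of the Taylor remainders at the knots.\<close>

lemma spline_curv_alt:
  assumes "(\<Sum>i\<in>UNIV. \<delta> $ i) = 0" and "(\<Sum>i\<in>UNIV. \<delta> $ i * Z $ i) = 0"
  shows "spline_curv Z \<delta> t = (\<Sum>i\<in>UNIV. \<delta> $ i * max 0 (Z $ i - t))"
proof -
  have "(\<Sum>i\<in>UNIV. \<delta> $ i * \<bar>t - Z $ i\<bar>)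
      = (\<Sum>i\<in>UNIV. 2 * (\<delta> $ i * max 0 (Z $ i - t)) + (t * \<delta> $ i - \<delta> $ i * Z $ i))"
    by (rule sum.cong) (auto simp: max_def algebra_simps abs_if)
  also have "\<dots> = 2 * (\<Sum>i\<in>UNIV. \<delta> $ i * max 0 (Z $ i - t))"
    using assms by (simp add: sum.distrib sum_subtractf flip: sum_distrib_left)
  finally show ?thesis
    by (simp add: spline_curv_def)
qed

text \<open>A continuous factor is bounded on a compact interval, so a multiple of
  \<open>\<bar>h\<bar>\<close> dominates the product.\<close>

lemma set_integrable_mult_continuous:
  fixes h k :: "real \<Rightarrow> real"
  assumes h: "set_integrable lborel {a..b} h" and k: "continuous_on UNIV k"
  shows "set_integrable lborel {a..b} (\<lambda>t. k t * h t)"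
proof -
  have [measurable]: "k \<in> borel_measurable borel"
    by (intro borel_measurable_continuous_onI k)
  have "bounded (k ` {a..b})"
    by (intro compact_imp_bounded compact_continuous_image continuous_on_subset[OF k]) auto
  then obtain B where B: "\<And>t. t \<in> {a..b} \<Longrightarrow> \<bar>k t\<bar> \<le> B"
    by (force simp: bounded_iff)
  have hi: "integrable lborel (\<lambda>t. indicator {a..b} t * h t)"
    using h by (simp add: set_integrable_def)
  then have [measurable]: "(\<lambda>t. indicator {a..b} t * h t) \<in> borel_measurable borel"
    by (auto dest: borel_measurable_integrable)
  have "integrable lborel (\<lambda>t. k t * (indicator {a..b} t * h t))"
  proof (rule Bochner_Integration.integrable_bound)
    show "integrable lborel (\<lambda>t. B * \<bar>indicator {a..b} t * h t\<bar>)"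
      using hi by auto
    show "AE t in lborel. norm (k t * (indicator {a..b} t * h t)) \<le> norm (B * \<bar>indicator {a..b} t * h t\<bar>)"
      using B by (intro AE_I2) (force simp: indicator_def abs_mult intro!: mult_right_mono)
  qed measurable
  then show ?thesis
    by (simp add: set_integrable_def algebra_simps)
qed

text \<open>Each kernel \<open>max 0 (Z $ i - t)\<close> yields the Taylor remainder of
  \<open>g\<close> at \<open>Z $ i\<close>; the Taylor polynomial is affine and drops out under the
  two constraints on \<open>\<delta>\<close>.\<close>

lemma integral_spline_curv_mult:
  fixes Z \<delta> :: "real^'n"
  assumes g: "\<And>z. z \<in> {0..1} \<Longrightarrow> (g has_vector_derivative g' z) (at z within {0..1})"
    and ac: "ac_density g' h"
    and Z: "\<And>i. Z $ i \<in> {0..1}"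
    and \<delta>0: "(\<Sum>i\<in>UNIV. \<delta> $ i) = 0" and \<delta>1: "(\<Sum>i\<in>UNIV. \<delta> $ i * Z $ i) = 0"
  shows "(LINT t:{0..1}|lborel. spline_curv Z \<delta> t * h t) = (\<Sum>i\<in>UNIV. \<delta> $ i * g (Z $ i))"
proof -
  have h: "set_integrable lborel {0..1} h"
    using ac by (simp add: ac_density_def)
  have si: "set_integrable lborel {0..1} (\<lambda>t. \<delta> $ i * max 0 (Z $ i - t) * h t)" for i
    by (rule set_integrable_mult_continuous[OF h]) (intro continuous_intros)
  have "(LINT t:{0..1}|lborel. spline_curv Z \<delta> t * h t)
      = (\<Sum>i\<in>UNIV. LINT t:{0..1}|lborel. \<delta> $ i * max 0 (Z $ i - t) * h t)"
    using si unfolding set_lebesgue_integral_def set_integrable_def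
    by (subst Bochner_Integration.integral_sum[symmetric])
      (auto simp: spline_curv_alt[OF \<delta>0 \<delta>1] sum_distrib_right sum_distrib_left)
  also have "\<dots> = (\<Sum>i\<in>UNIV. \<delta> $ i * (g (Z $ i) - g 0 - g' 0 * Z $ i))"
  proof (rule sum.cong)
    fix i
    have "(LINT t:{0..1}|lborel. \<delta> $ i * max 0 (Z $ i - t) * h t)
        = \<delta> $ i * (LINT t:{0..Z $ i}|lborel. (Z $ i - t) * h t)"
      unfolding set_lebesgue_integral_def
      by (subst integral_mult_right_zero[symmetric], rule Bochner_Integration.integral_cong)
        (use Z[of i] in \<open>auto simp: indicator_def max_def\<close>)
    also have "(LINT t:{0..Z $ i}|lborel. (Z $ i - t) * h t) = g (Z $ i) - g 0 - g' 0 * Z $ i"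
      using ac_taylor[OF g ac Z[of i]] by simp
    finally show "(LINT t:{0..1}|lborel. \<delta> $ i * max 0 (Z $ i - t) * h t)
      = \<delta> $ i * (g (Z $ i) - g 0 - g' 0 * Z $ i)" .
  qed simp
  also have "\<dots> = (\<Sum>i\<in>UNIV. \<delta> $ i * g (Z $ i)) - g 0 * (\<Sum>i\<in>UNIV. \<delta> $ i)
      - g' 0 * (\<Sum>i\<in>UNIV. \<delta> $ i * Z $ i)"
    by (simp add: sum_subtractf sum_distrib_left right_diff_distrib mult_ac)
  finally show ?thesis
    using \<delta>0 \<delta>1 by simp
qed

section \<open>The linear system\<close>

lemma invertible_if_ker_trivial:
  fixes A :: "real^'n^'n"
  assumes "\<And>x. A *v x = 0 \<Longrightarrow> x = 0"
  shows "invertible A"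
  using assms by (simp add: invertible_left_inverse matrix_left_invertible_ker)

lemma matrix_inv_mult:
  assumes "invertible A"
  shows "A ** matrix_inv A = mat 1" "matrix_inv A ** A = mat 1"
  using someI_ex[OF assms[unfolded invertible_def]] by (simp_all add: matrix_inv_def)

lemma Z_mat_mult: "Z_mat Z *v a = (\<chi> i. a $ 1 + a $ 2 * Z $ i)"
  by (simp add: vec_eq_iff Z_mat_def matrix_vector_mult_def sum_2 mult.commute)

lemma transpose_Z_mat_mult_eq_0_iff:
  "transpose (Z_mat Z) *v \<delta> = 0 \<longleftrightarrow> (\<Sum>i\<in>UNIV. \<delta> $ i) = 0 \<and> (\<Sum>i\<in>UNIV. \<delta> $ i * Z $ i) = 0"
  by (simp add: vec_eq_iff forall_2 Z_mat_def matrix_vector_mult_def transpose_def mult.commute)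

lemma block_matrix_mult_block_vector:
  fixes A :: "real^'m^'k" and B :: "real^'n^'k" and C :: "real^'m^'l" and D :: "real^'n^'l"
  shows "block_matrix A B C D *v block_vector u v = block_vector (A *v u + B *v v) (C *v u + D *v v)"
  by (simp add: vec_eq_iff split_sum_all matrix_vector_mult_def block_matrix_def block_vector_def
      sum.Plus flip: UNIV_Plus_UNIV)

lemma block_vector_eq_iff: "block_vector u v = block_vector u' v' \<longleftrightarrow> u = u' \<and> v = v'"
  by (auto simp: vec_eq_iff split_sum_all block_vector_def)

lemma block_vector_surj: "\<exists>u v. x = block_vector u v"
  by (rule exI[of _ "\<chi> k. x $ Inl k"], rule exI[of _ "\<chi> k. x $ Inr k"])
    (simp add: vec_eq_iff split_sum_all block_vector_def)

lemma spline_system_iff: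
  "spline_system Y Z W \<mu> lam \<delta> a \<longleftrightarrow>
     E_tilde Z W \<mu> lam *v \<delta> + Z_mat Z *v a = Y \<and>
     (\<Sum>i\<in>UNIV. \<delta> $ i) = 0 \<and> (\<Sum>i\<in>UNIV. \<delta> $ i * Z $ i) = 0"
  unfolding spline_system_def block_matrix_mult_block_vector block_vector_eq_iff
  by (simp add: transpose_Z_mat_mult_eq_0_iff del: transpose_matrix_vector)

lemma E_tilde_mult:
  "E_tilde Z W \<mu> lam *v x = E_mat Z *v x + lam *\<^sub>R (matrix_inv (Omega_mat \<mu> W) *v x)"
  by (simp add: E_tilde_def matrix_vector_mult_add_rdistrib scaleR_matrix_vector_assoc)

lemma spline_fun_knots: "(\<chi> i. spline_fun Z \<delta> a (Z $ i)) = E_mat Z *v \<delta> + Z_mat Z *v a"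
  unfolding Z_mat_mult
  by (simp add: vec_eq_iff spline_fun_def E_mat_def matrix_vector_mult_def
      sum_divide_distrib mult.commute)

lemma spline_fun_diff:
  "spline_fun Z (\<delta> - \<delta>') (a - a') z = spline_fun Z \<delta> a z - spline_fun Z \<delta>' a' z"
  by (simp add: spline_fun_def algebra_simps sum_subtractf diff_divide_distrib)

section \<open>Splines determined by their values at the knots\<close>

locale spline_knots =
  fixes Z :: "real^'n"
  assumes card: "CARD('n) \<ge> 2"
    and Z_range: "\<And>i. Z $ i \<in> {0..1}"
    and Z_inj: "inj (\<lambda>i. Z $ i)"
begin

lemma two_knots: obtains i j where "Z $ i \<noteq> Z $ j"
proof -
  have "1 < card (UNIV :: 'n set)"
    using card by simp
  then obtain i j :: 'n where "i \<noteq> j"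
    by (metis (full_types) One_nat_def card_le_Suc0_iff_eq finite_class.finite_UNIV not_less)
  then show ?thesis
    using that Z_inj by (auto simp: inj_def)
qed

text \<open>An affine function with two distinct zeros is zero.\<close>

lemma affine_eq_0:
  assumes "\<And>i. a + b * Z $ i = 0"
  shows "a = 0" "b = 0"
proof -
  obtain i j where ij: "Z $ i \<noteq> Z $ j"
    by (rule two_knots)
  have "b * (Z $ i - Z $ j) = 0"
    using assms[of i] assms[of j] unfolding right_diff_distrib by linarith
  with ij show "b = 0" by simp
  with assms[of i] show "a = 0" by simp
qed

lemma Z_mat_mult_eq_0: "Z_mat Z *v a = 0 \<Longrightarrow> a = 0"
  using affine_eq_0[of "a $ 1" "a $ 2"] unfolding Z_mat_mult vec_eq_iff forall_2 by auto

context
  fixes \<delta> :: "real^'n"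
  assumes \<delta>0: "(\<Sum>i\<in>UNIV. \<delta> $ i) = 0" and \<delta>1: "(\<Sum>i\<in>UNIV. \<delta> $ i * Z $ i) = 0"
begin

text \<open>The pairing identity in the form applied below to the spline itself and to
  polynomials.\<close>

lemma integral_spline_curv_mult_deriv2:
  assumes "\<And>z. (g has_real_derivative g' z) (at z)" and "\<And>z. (g' has_real_derivative h z) (at z)"
    and "continuous_on {0..1} h"
  shows "(LINT t:{0..1}|lborel. spline_curv Z \<delta> t * h t) = (\<Sum>i\<in>UNIV. \<delta> $ i * g (Z $ i))"
  by (rule integral_spline_curv_mult[OF _ ac_densityI_deriv[OF assms(2,3)] Z_range \<delta>0 \<delta>1])
    (use assms(1) in \<open>auto simp: has_real_derivative_iff_has_vector_derivative
      intro: has_vector_derivative_at_within\<close>)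

lemma integral_spline_curv_squared:
  "(LINT t:{0..1}|lborel. (spline_curv Z \<delta> t)\<^sup>2) = (\<Sum>i\<in>UNIV. \<delta> $ i * spline_fun Z \<delta> a (Z $ i))"
  using integral_spline_curv_mult_deriv2[OF spline_fun_deriv spline_slope_deriv continuous_on_spline_curv]
  by (simp add: power2_eq_square)

lemma E_quadratic_form: "\<delta> \<bullet> (E_mat Z *v \<delta>) = (LINT t:{0..1}|lborel. (spline_curv Z \<delta> t)\<^sup>2)"
  using arg_cong[OF spline_fun_knots[of Z \<delta> 0], of "\<lambda>v. \<delta> \<bullet> v"]
  by (simp add: integral_spline_curv_squared[of 0] inner_vec_def)

text \<open>\<open>E_mat\<close> has zero diagonal and is indefinite for distinct knots; under the
  two constraints on \<open>\<delta>\<close>, however, its form is the integral of a square.\<close>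

lemma E_nonneg: "\<delta> \<bullet> (E_mat Z *v \<delta>) \<ge> 0"
  unfolding E_quadratic_form set_lebesgue_integral_def
  by (rule Bochner_Integration.integral_nonneg) simp

text \<open>Pairing the spline with the polynomial vanishing at all knots but one isolates the
  corresponding coefficient.\<close>

lemma spline_knots_eq_0:
  assumes zero: "\<And>i. spline_fun Z \<delta> a (Z $ i) = 0"
  shows "\<delta> = 0" "a = 0"
proof -
  \<comment> \<open>The energy is a linear combination of the values at the knots, which are zero;
    hence the curvature vanishes almost everywhere on the unit interval.\<close>
  have "(LINT t:{0..1}|lborel. (spline_curv Z \<delta> t)\<^sup>2) = 0"
    by (simp add: integral_spline_curv_squared[of a] zero)
  with set_integrable_spline_curv_power2[of 0 1 Z \<delta>]
  have AE: "AE t in lborel. indicator {0..1} t * (spline_curv Z \<delta> t)\<^sup>2 = 0"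
    unfolding set_integrable_def set_lebesgue_integral_def
    by (subst (asm) integral_nonneg_eq_0_iff_AE) auto
  have "\<delta> $ i = 0" for i
  proof -
    define p where "p = (\<Prod>j\<in>- {i}. [:- Z $ j, 1:])"
    have pj: "poly p (Z $ j) = 0" if "j \<noteq> i" for j
      using that by (auto simp: p_def poly_prod)
    have pi: "poly p (Z $ i) \<noteq> 0"
      using Z_inj by (auto simp: p_def poly_prod inj_def)
    have "\<delta> $ i * poly p (Z $ i) = (\<Sum>j\<in>UNIV. \<delta> $ j * poly p (Z $ j))"
      by (subst sum.mono_neutral_right[of UNIV "{i}"]) (auto simp: pj)
    also have "\<dots> = (LINT t:{0..1}|lborel. spline_curv Z \<delta> t * poly (pderiv (pderiv p)) t)"
      by (rule integral_spline_curv_mult_deriv2[symmetric])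
        (auto intro: poly_DERIV continuous_intros)
    also have "\<dots> = 0"
      unfolding set_lebesgue_integral_def
      by (rule integral_eq_zero_AE, use AE in eventually_elim) (auto simp: indicator_def)
    finally show ?thesis
      using pi by simp
  qed
  then show "\<delta> = 0"
    by (simp add: vec_eq_iff)
  moreover have "(\<chi> i. spline_fun Z \<delta> a (Z $ i)) = 0"
    by (simp add: vec_eq_iff zero)
  ultimately have "Z_mat Z *v a = 0"
    by (simp add: spline_fun_knots)
  then show "a = 0"
    by (rule Z_mat_mult_eq_0)
qed

end

end

section \<open>Solvability of the block system and elimination\<close>

locale smoothing_spline = spline_knots Z + prob_space \<mu>
  for Z :: "real^'n" and \<mu> :: "(real^'p) measure" +
  fixes W :: "real^'p^'n" and lam :: real
  assumes sets_mu: "sets \<mu> = sets borel" and support: "measure_support \<mu> = UNIV"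
    and lam_pos: "lam > 0" and W_inj: "inj (\<lambda>i. W $ i)"
begin

lemma Omega_invertible: "invertible (Omega_mat \<mu> W)"
  by (rule invertible_if_ker_trivial)
    (auto intro: Omega_pos_def[OF prob_space_axioms sets_mu support W_inj])

lemma Omega_inv_mult:
  "Omega_mat \<mu> W *v (matrix_inv (Omega_mat \<mu> W) *v x) = x"
  using Omega_invertible by (simp add: matrix_vector_mul_assoc matrix_inv_mult)

text \<open>Pairing the first block row with \<open>\<delta>\<close> removes the affine part and
  leaves the form of \<open>E_mat\<close> at \<open>\<delta>\<close> plus \<open>lam\<close> times
  the form of \<open>Omega_mat\<close> at \<open>x\<close>, where \<open>x\<close> is the preimage
  of \<open>\<delta>\<close> under \<open>Omega_mat\<close>. Both are nonnegative with sum zero, so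
  positive definiteness gives \<open>x = 0\<close>.\<close>

lemma spline_system_homogeneous:
  assumes "spline_system 0 Z W \<mu> lam \<delta> a"
  shows "\<delta> = 0" "a = 0"
proof -
  have \<delta>: "(\<Sum>i\<in>UNIV. \<delta> $ i) = 0" "(\<Sum>i\<in>UNIV. \<delta> $ i * Z $ i) = 0"
    and eq: "E_tilde Z W \<mu> lam *v \<delta> + Z_mat Z *v a = 0"
    using assms by (auto simp: spline_system_iff)
  define x where "x = matrix_inv (Omega_mat \<mu> W) *v \<delta>"
  have x: "\<delta> = Omega_mat \<mu> W *v x"
    by (simp add: x_def Omega_inv_mult)
  have "\<delta> \<bullet> (Z_mat Z *v a) = 0"
    using \<delta> by (metis transpose_Z_mat_mult_eq_0_iff dot_lmul_matrix inner_zero_left transpose_matrix_vector)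
  then have "\<delta> \<bullet> (E_mat Z *v \<delta>) + lam * (x \<bullet> (Omega_mat \<mu> W *v x)) = 0"
    using arg_cong[OF eq, of "\<lambda>v. \<delta> \<bullet> v"]
    by (simp add: E_tilde_mult inner_add_right x_def[symmetric] inner_commute[of \<delta> x] flip: x)
  moreover have "x \<bullet> (Omega_mat \<mu> W *v x) \<ge> 0"
    by (rule Omega_nonneg[OF prob_space_axioms sets_mu])
  moreover note E_nonneg[OF \<delta>]
  ultimately have "x \<bullet> (Omega_mat \<mu> W *v x) = 0"
    using lam_pos by (smt (verit) mult_pos_pos)
  then have "x = 0"
    by (rule Omega_pos_def[OF prob_space_axioms sets_mu support W_inj])
  then show "\<delta> = 0"
    by (simp add: x)
  with eq show "a = 0"
    by (auto intro: Z_mat_mult_eq_0)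
qed

text \<open>The block matrix is square with trivial kernel, hence invertible, which gives existence
  and uniqueness together.\<close>

lemma spline_system_unique_solution: "\<exists>!(\<delta>, a). spline_system Y Z W \<mu> lam \<delta> a"
proof -
  define M where "M = block_matrix (E_tilde Z W \<mu> lam) (Z_mat Z) (transpose (Z_mat Z)) (0 :: real^2^2)"
  have "invertible M"
  proof (rule invertible_if_ker_trivial)
    fix x assume Mx: "M *v x = 0"
    obtain \<delta> a where x: "x = block_vector \<delta> a"
      using block_vector_surj by blast
    have b0: "block_vector 0 0 = (0 :: real^('n + 2))"
      by (simp add: vec_eq_iff split_sum_all block_vector_def)
    have "spline_system 0 Z W \<mu> lam \<delta> a"
      using Mx by (simp add: spline_system_def x M_def b0)
    with spline_system_homogeneous[of \<delta> a] show "x = 0"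
      by (simp add: x b0)
  qed
  then have inv: "M *v x = y \<longleftrightarrow> x = matrix_inv M *v y" for x y
    by (metis matrix_inv_mult matrix_vector_mul_assoc matrix_vector_mul_lid)
  obtain \<delta> a where sol: "matrix_inv M *v block_vector Y 0 = block_vector \<delta> a"
    using block_vector_surj by blast
  have "spline_system Y Z W \<mu> lam \<delta>' a' \<longleftrightarrow> \<delta>' = \<delta> \<and> a' = a" for \<delta>' a'
    unfolding spline_system_def M_def[symmetric] inv sol block_vector_eq_iff ..
  then show ?thesis
    by (intro ex1I[of _ "(\<delta>, a)"]) auto
qed

text \<open>Block elimination of \<open>\<delta>\<close>. Invertibility of \<open>E_tilde\<close> is
  a genuine condition: for two knots, (1, -1) is an eigenvector whose eigenvalue vanishes at exactly
  one positive value of \<open>lam\<close>.\<close>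

lemma closed_form:
  assumes sys: "spline_system Y Z W \<mu> lam \<delta> a" and Et: "invertible (E_tilde Z W \<mu> lam)"
  shows "invertible (transpose (Z_mat Z) ** matrix_inv (E_tilde Z W \<mu> lam) ** Z_mat Z)"
    and "E_mat Z *v \<delta> + Z_mat Z *v a = (P_mat Z W \<mu> lam
           + E_mat Z ** matrix_inv (E_tilde Z W \<mu> lam) ** (mat 1 - P_mat Z W \<mu> lam)) *v Y"
proof -
  let ?E = "E_tilde Z W \<mu> lam" and ?Z = "Z_mat Z"
  let ?V = "transpose ?Z ** matrix_inv ?E ** ?Z"
  have right: "?E *v (matrix_inv ?E *v x) = x" and left: "matrix_inv ?E *v (?E *v x) = x" for x
    using Et by (simp_all add: matrix_vector_mul_assoc matrix_inv_mult)
  show V: "invertible ?V"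
  proof (rule invertible_if_ker_trivial)
    fix b assume "?V *v b = 0"
    then have "transpose ?Z *v (matrix_inv ?E *v (?Z *v b)) = 0"
      by (simp add: matrix_vector_mul_assoc matrix_mul_assoc)
    moreover have "?Z *v (- b) = - (?Z *v b)"
      by (simp add: Z_mat_mult vec_eq_iff)
    \<comment> \<open>A kernel vector \<open>b\<close> of \<open>?V\<close> extends to a solution of
      the homogeneous system with affine part \<open>- b\<close>.\<close>
    ultimately have "spline_system 0 Z W \<mu> lam (matrix_inv ?E *v (?Z *v b)) (- b)"
      by (simp add: spline_system_iff right transpose_Z_mat_mult_eq_0_iff del: transpose_matrix_vector)
    from spline_system_homogeneous(2)[OF this] show "b = 0"
      by simp
  qed
  have eq: "?E *v \<delta> + ?Z *v a = Y" and tr: "transpose ?Z *v \<delta> = 0"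
    using sys by (auto simp: spline_system_iff transpose_Z_mat_mult_eq_0_iff simp del: transpose_matrix_vector)
  have "matrix_inv ?E *v Y = \<delta> + matrix_inv ?E *v (?Z *v a)"
    by (simp add: left matrix_vector_right_distrib flip: eq)
  \<comment> \<open>The transpose of \<open>?Z\<close> annihilates \<open>\<delta>\<close>, which
    leaves generalized least squares equations for \<open>a\<close>.\<close>
  then have "transpose ?Z *v (matrix_inv ?E *v Y) = ?V *v a"
    by (simp add: matrix_vector_right_distrib tr matrix_vector_mul_assoc matrix_mul_assoc
        del: transpose_matrix_vector)
  then have "P_mat Z W \<mu> lam *v Y = ?Z *v (matrix_inv ?V *v (?V *v a))"
    by (simp add: P_mat_def flip: matrix_vector_mul_assoc)
  also have "matrix_inv ?V *v (?V *v a) = a"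
    using V by (simp add: matrix_vector_mul_assoc matrix_inv_mult)
  \<comment> \<open>Thus \<open>P_mat\<close> extracts the affine part of the fitted values.\<close>
  finally have P: "P_mat Z W \<mu> lam *v Y = ?Z *v a" .
  have "?E *v \<delta> = Y - P_mat Z W \<mu> lam *v Y"
    using eq by (simp add: P algebra_simps)
  then have "\<delta> = matrix_inv ?E *v (Y - P_mat Z W \<mu> lam *v Y)"
    using left by metis
  then show "E_mat Z *v \<delta> + ?Z *v a = (P_mat Z W \<mu> lam
           + E_mat Z ** matrix_inv ?E ** (mat 1 - P_mat Z W \<mu> lam)) *v Y"
    by (simp add: P matrix_vector_mult_add_rdistrib matrix_vector_mult_diff_rdistrib
        flip: matrix_vector_mul_assoc)
qed

end

section \<open>Expansion of the criterion around the spline\<close>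

lemma has_vector_derivative_first_deriv:
  assumes "g \<in> function_class" and "z \<in> {0..1}"
  shows "(g has_vector_derivative first_deriv g z) (at z within {0..1})"
  using assms by (simp add: function_class_def first_deriv_def vector_derivative_works)

lemma ac_density_second_deriv:
  assumes "g \<in> function_class"
  shows "ac_density (first_deriv g) (second_deriv g)"
  unfolding second_deriv_def by (rule someI_ex[of "ac_density (first_deriv g)"]) (use assms in \<open>simp add: function_class_def\<close>)

lemma has_vector_derivative_restrict_spline_fun:
  assumes "z \<in> {0..1}"
  shows "(restrict (spline_fun Z \<delta> a) {0..1} has_vector_derivative spline_slope Z \<delta> a z) (at z within {0..1})"
proof -
  have "(spline_fun Z \<delta> a has_vector_derivative spline_slope Z \<delta> a z) (at z within {0..1})"
    by (rule has_vector_derivative_at_within, rule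
        spline_fun_deriv[unfolded has_real_derivative_iff_has_vector_derivative])
  then show ?thesis
    by (rule has_vector_derivative_transform[OF assms, rotated]) simp
qed

text \<open>Derivatives within a nondegenerate closed interval are unique, also at the end
  points.\<close>

lemma first_deriv_restrict_spline_fun:
  assumes "z \<in> {0..1}"
  shows "first_deriv (restrict (spline_fun Z \<delta> a) {0..1}) z = spline_slope Z \<delta> a z"
  unfolding first_deriv_def
  using vector_derivative_within_closed_interval[OF _ assms has_vector_derivative_restrict_spline_fun[OF assms]]
  by simp

lemma ac_density_spline_curv:
  "ac_density (first_deriv (restrict (spline_fun Z \<delta> a) {0..1})) (spline_curv Z \<delta>)"
  by (rule ac_densityI_deriv[OF spline_slope_deriv continuous_on_spline_curv])
    (rule first_deriv_restrict_spline_fun)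

lemma restrict_spline_fun_in_function_class: "restrict (spline_fun Z \<delta> a) {0..1} \<in> function_class"
  unfolding function_class_def
proof (intro CollectI conjI ballI exI)
  show "restrict (spline_fun Z \<delta> a) {0..1} differentiable (at z within {0..1})" if "z \<in> {0..1}" for z
    by (rule differentiableI_vector[OF has_vector_derivative_restrict_spline_fun[OF that]])
qed (simp, rule ac_density_spline_curv)

lemma set_nn_integral_eq_set_integral:
  fixes f :: "'a \<Rightarrow> real"
  assumes "set_integrable M A f" and "\<And>x. 0 \<le> f x"
  shows "(\<integral>\<^sup>+x\<in>A. ennreal (f x) \<partial>M) = ennreal (LINT x:A|M. f x)"
proof -
  have "(\<integral>\<^sup>+x\<in>A. ennreal (f x) \<partial>M) = (\<integral>\<^sup>+x. ennreal (indicator A x * f x) \<partial>M)"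
    by (intro nn_integral_cong) (simp add: indicator_def)
  also have "\<dots> = ennreal (LINT x:A|M. f x)"
    using assms unfolding set_integrable_def set_lebesgue_integral_def
    by (subst nn_integral_eq_integral) auto
  finally show ?thesis .
qed

lemma set_integral_power2_nonneg:
  fixes f :: "'a \<Rightarrow> real"
  shows "0 \<le> (LINT x:A|M. (f x)\<^sup>2)"
  unfolding set_lebesgue_integral_def by (rule Bochner_Integration.integral_nonneg) simp

text \<open>Measurability comes from the integrability of \<open>f\<close> on \<open>A\<close>,
  finiteness from the nonnegative integral.\<close>

lemma set_integrable_power2:
  fixes f :: "real \<Rightarrow> real"
  assumes "set_integrable M A f" and "(\<integral>\<^sup>+x\<in>A. ennreal (\<bar>f x\<bar>\<^sup>2) \<partial>M) < \<infinity>"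
  shows "set_integrable M A (\<lambda>x. (f x)\<^sup>2)"
  unfolding set_integrable_def
proof (rule integrableI_nonneg)
  have "(\<lambda>x. indicator A x *\<^sub>R f x) \<in> borel_measurable M"
    using assms(1) unfolding set_integrable_def by (rule borel_measurable_integrable)
  then have "(\<lambda>x. (indicator A x *\<^sub>R f x)\<^sup>2) \<in> borel_measurable M"
    by measurable
  also have "(\<lambda>x. (indicator A x *\<^sub>R f x)\<^sup>2) = (\<lambda>x. indicator A x *\<^sub>R (f x)\<^sup>2)"
    by (simp add: fun_eq_iff indicator_def)
  finally show "(\<lambda>x. indicator A x *\<^sub>R (f x)\<^sup>2) \<in> borel_measurable M" .
  have "(\<integral>\<^sup>+x. ennreal (indicator A x *\<^sub>R (f x)\<^sup>2) \<partial>M) = (\<integral>\<^sup>+x\<in>A. ennreal (\<bar>f x\<bar>\<^sup>2) \<partial>M)"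
    by (intro nn_integral_cong) (simp add: indicator_def)
  with assms(2) show "(\<integral>\<^sup>+x. ennreal (indicator A x *\<^sub>R (f x)\<^sup>2) \<partial>M) < \<infinity>"
    by simp
qed simp

lemma quadratic_form_minus:
  fixes A :: "real^'n^'n"
  assumes "transpose A = A"
  shows "(r - h) \<bullet> (A *v (r - h)) = r \<bullet> (A *v r) - 2 * (h \<bullet> (A *v r)) + h \<bullet> (A *v h)"
proof -
  have "r \<bullet> (A *v h) = h \<bullet> (A *v r)"
    using assms by (metis dot_lmul_matrix inner_commute transpose_matrix_vector)
  then show ?thesis
    by (simp add: matrix_vector_mult_diff_distrib inner_diff_left inner_diff_right)
qed

section \<open>Minimality of the spline and uniqueness of the minimizer\<close>

context smoothing_spline
begin

abbreviation crit :: "real^'n \<Rightarrow> (real \<Rightarrow> real) \<Rightarrow> ennreal" where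
  "crit Y \<equiv> criterion Y Z W \<mu> lam"

lemma fit_nonneg: "0 \<le> r \<bullet> (Omega_mat \<mu> W *v r)"
  by (rule Omega_nonneg[OF prob_space_axioms sets_mu])

lemma penalty_nonneg: "0 \<le> lam * (LINT z:{0..1}|lborel. (f z)\<^sup>2)"
  using lam_pos by (intro mult_nonneg_nonneg set_integral_power2_nonneg) simp

lemma criterion_eq:
  "crit Y g = ennreal ((Y - (\<chi> i. g (Z $ i))) \<bullet> (Omega_mat \<mu> W *v (Y - (\<chi> i. g (Z $ i)))))
     + ennreal lam * (\<integral>\<^sup>+ z\<in>{0..1}. ennreal (\<bar>second_deriv g z\<bar>\<^sup>2) \<partial>lborel)"
  unfolding criterion_def nn_integral_trig_sum[OF prob_space_axioms sets_mu, symmetric] by simp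

text \<open>Since \<open>lam > 0\<close>, a finite criterion forces a finite penalty; the
  extended-real value then becomes a real expression that can be expanded.\<close>

lemma criterion_finite:
  assumes g: "g \<in> function_class" and fin: "crit Y g < \<infinity>"
  shows "set_integrable lborel {0..1} (\<lambda>z. (second_deriv g z)\<^sup>2)"
    and "crit Y g = ennreal ((Y - (\<chi> i. g (Z $ i))) \<bullet> (Omega_mat \<mu> W *v (Y - (\<chi> i. g (Z $ i))))
     + lam * (LINT z:{0..1}|lborel. (second_deriv g z)\<^sup>2))"
proof -
  have "(\<integral>\<^sup>+ z\<in>{0..1}. ennreal (\<bar>second_deriv g z\<bar>\<^sup>2) \<partial>lborel) < \<infinity>"
    using fin lam_pos by (auto simp: criterion_eq ennreal_mult_less_top less_top[symmetric] ennreal_mult_eq_top_iff)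
  then show int: "set_integrable lborel {0..1} (\<lambda>z. (second_deriv g z)\<^sup>2)"
    using ac_density_second_deriv[OF g] by (intro set_integrable_power2) (auto simp: ac_density_def)
  show "crit Y g = ennreal ((Y - (\<chi> i. g (Z $ i))) \<bullet> (Omega_mat \<mu> W *v (Y - (\<chi> i. g (Z $ i))))
     + lam * (LINT z:{0..1}|lborel. (second_deriv g z)\<^sup>2))"
    using set_nn_integral_eq_set_integral[OF int] lam_pos
    by (simp add: criterion_eq ennreal_mult' fit_nonneg penalty_nonneg)
qed

context
  fixes Y \<delta> :: "real^'n" and a :: "real^2"
  assumes sys: "spline_system Y Z W \<mu> lam \<delta> a"
begin

abbreviation "spl \<equiv> restrict (spline_fun Z \<delta> a) {0..1}"

definition "resid = Y - (\<chi> i. spline_fun Z \<delta> a (Z $ i))"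

definition "cost = resid \<bullet> (Omega_mat \<mu> W *v resid)
  + lam * (LINT z:{0..1}|lborel. (spline_curv Z \<delta> z)\<^sup>2)"

lemma spl_knots: "spl (Z $ i) = spline_fun Z \<delta> a (Z $ i)"
  using Z_range by simp

lemma cost_nonneg: "0 \<le> cost"
  unfolding cost_def by (intro add_nonneg_nonneg fit_nonneg penalty_nonneg)

text \<open>The first block row says that the residual is \<open>lam\<close> times the inverse of
  \<open>Omega_mat\<close> applied to \<open>\<delta>\<close>.\<close>

lemma Omega_resid: "Omega_mat \<mu> W *v resid = lam *\<^sub>R \<delta>"
proof -
  have "resid = lam *\<^sub>R (matrix_inv (Omega_mat \<mu> W) *v \<delta>)"
    using sys by (auto simp: resid_def spline_fun_knots spline_system_iff E_tilde_mult algebra_simps)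
  then show ?thesis
    by (simp add: matrix_vector_mult_scaleR Omega_inv_mult)
qed

lemma criterion_spl: "crit Y spl = ennreal cost"
proof -
  have "(\<integral>\<^sup>+ z\<in>{0..1}. ennreal (\<bar>second_deriv spl z\<bar>\<^sup>2) \<partial>lborel)
      = (\<integral>\<^sup>+ z\<in>{0..1}. ennreal ((spline_curv Z \<delta> z)\<^sup>2) \<partial>lborel)"
    \<comment> \<open>The density chosen by \<open>second_deriv\<close> is known to agree with
      \<open>spline_curv\<close> only almost everywhere.\<close>
    using ac_density_AE_eq[OF ac_density_second_deriv[OF restrict_spline_fun_in_function_class]
        ac_density_spline_curv, of Z \<delta> a]
    by (intro nn_integral_cong_AE) (auto elim!: eventually_mono simp: indicator_def)
  also have "\<dots> = ennreal (LINT z:{0..1}|lborel. (spline_curv Z \<delta> z)\<^sup>2)"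
    by (rule set_nn_integral_eq_set_integral[OF set_integrable_spline_curv_power2]) simp
  finally show ?thesis
    using lam_pos
    by (simp add: criterion_eq cost_def ennreal_mult' fit_nonneg penalty_nonneg
        resid_def Z_range[simplified])
qed

lemma criterion_decomp:
  assumes g: "g \<in> function_class" and fin: "crit Y g < \<infinity>"
  defines "h \<equiv> (\<chi> i. g (Z $ i) - spline_fun Z \<delta> a (Z $ i))"
  shows "set_integrable lborel {0..1} (\<lambda>z. (second_deriv g z - spline_curv Z \<delta> z)\<^sup>2)"
    and "crit Y g = ennreal (cost + (h \<bullet> (Omega_mat \<mu> W *v h)
      + lam * (LINT z:{0..1}|lborel. (second_deriv g z - spline_curv Z \<delta> z)\<^sup>2)))"
proof -
  define d where "d = (\<lambda>z. second_deriv g z - spline_curv Z \<delta> z)"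
  let ?S = "spline_curv Z \<delta>" and ?G = "second_deriv g"
  have \<delta>: "(\<Sum>i\<in>UNIV. \<delta> $ i) = 0" "(\<Sum>i\<in>UNIV. \<delta> $ i * Z $ i) = 0"
    using sys by (auto simp: spline_system_iff)
  note G2 = criterion_finite(1)[OF g fin]
  have G: "set_integrable lborel {0..1} ?G"
    using ac_density_second_deriv[OF g] by (simp add: ac_density_def)
  have SG: "set_integrable lborel {0..1} (\<lambda>z. ?S z * ?G z)"
    by (rule set_integrable_mult_continuous[OF G continuous_on_spline_curv])
  note S2 = set_integrable_spline_curv_power2[of 0 1 Z \<delta>]
  have "set_integrable lborel {0..1} (\<lambda>z. (?G z)\<^sup>2 - 2 * (?S z * ?G z) + (?S z)\<^sup>2)"
    by (intro set_integral_add set_integral_diff set_integrable_mult_right G2 SG S2)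
  moreover have d2: "(d z)\<^sup>2 = (?G z)\<^sup>2 - 2 * (?S z * ?G z) + (?S z)\<^sup>2" for z
    by (simp add: d_def power2_diff)
  ultimately show "set_integrable lborel {0..1} (\<lambda>z. (second_deriv g z - spline_curv Z \<delta> z)\<^sup>2)"
    by (simp add: d_def)
  have intd: "(LINT z:{0..1}|lborel. (d z)\<^sup>2) = (LINT z:{0..1}|lborel. (?G z)\<^sup>2)
      - 2 * (LINT z:{0..1}|lborel. ?S z * ?G z) + (LINT z:{0..1}|lborel. (?S z)\<^sup>2)"
    unfolding d2
    by (simp add: set_integral_add set_integral_diff set_integrable_mult_right G2 SG S2)
  have "(LINT z:{0..1}|lborel. ?S z * ?G z) = (\<Sum>i\<in>UNIV. \<delta> $ i * g (Z $ i))"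
    by (rule integral_spline_curv_mult[OF has_vector_derivative_first_deriv[OF g]
        ac_density_second_deriv[OF g] Z_range \<delta>])
  \<comment> \<open>Both integrals are pairings of \<open>\<delta>\<close> with knot values, of
    \<open>g\<close> and of the spline, so their difference sees only \<open>h\<close>.\<close>
  then have "(LINT z:{0..1}|lborel. ?S z * ?G z) - (LINT z:{0..1}|lborel. (?S z)\<^sup>2) = h \<bullet> \<delta>"
    unfolding integral_spline_curv_squared[OF \<delta>, of a]
    by (simp add: h_def inner_vec_def sum_subtractf algebra_simps)
  \<comment> \<open>By \<open>Omega_resid\<close>, \<open>lam * (h \<bullet> \<delta>)\<close>
    equals the cross term of the data fit. It enters twice from the penalty and cancels the
    \<open>- 2\<close> in \<open>quadratic_form_minus\<close>.\<close>
  then have cross: "lam * (LINT z:{0..1}|lborel. ?S z * ?G z)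
      = lam * (LINT z:{0..1}|lborel. (?S z)\<^sup>2) + h \<bullet> (Omega_mat \<mu> W *v resid)"
    by (simp add: Omega_resid algebra_simps)
  have res: "Y - (\<chi> i. g (Z $ i)) = resid - h"
    by (simp add: vec_eq_iff resid_def h_def)
  have "crit Y g = ennreal (cost + (h \<bullet> (Omega_mat \<mu> W *v h) + lam * (LINT z:{0..1}|lborel. (d z)\<^sup>2)))"
    unfolding criterion_finite(2)[OF g fin] res quadratic_form_minus[OF Omega_sym] intd cost_def
    unfolding distrib_left right_diff_distrib
    using cross by (intro arg_cong[of _ _ ennreal]) linarith
  then show "crit Y g = ennreal (cost + (h \<bullet> (Omega_mat \<mu> W *v h)
      + lam * (LINT z:{0..1}|lborel. (second_deriv g z - spline_curv Z \<delta> z)\<^sup>2)))"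
    by (simp add: d_def)
qed

lemma criterion_spl_le:
  assumes g: "g \<in> function_class"
  shows "crit Y spl \<le> crit Y g"
proof (cases "crit Y g < \<infinity>")
  case True
  show ?thesis
    unfolding criterion_decomp(2)[OF g True] criterion_spl
    using add_nonneg_nonneg[OF fit_nonneg penalty_nonneg] by (intro ennreal_leI) simp
qed (auto simp: less_top[symmetric])

text \<open>Both excess terms must vanish. Then \<open>g\<close> and the spline agree at the knots
  and have the same second derivative almost everywhere, so by Taylor's formula they differ by an
  affine function with at least two zeros.\<close>

lemma eq_spl_if_criterion_le:
  assumes g: "g \<in> function_class" and le: "crit Y g \<le> crit Y spl"
  shows "g = spl"
proof -
  have fin: "crit Y g < \<infinity>"
    using le by (simp add: criterion_spl order_le_less_trans)
  define h where "h = (\<chi> i. g (Z $ i) - spline_fun Z \<delta> a (Z $ i))"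
  let ?d2 = "\<lambda>z. (second_deriv g z - spline_curv Z \<delta> z)\<^sup>2"
  note dec = criterion_decomp[OF g fin, folded h_def]
  have nn: "0 \<le> h \<bullet> (Omega_mat \<mu> W *v h)" "0 \<le> lam * (LINT z:{0..1}|lborel. ?d2 z)"
    by (rule fit_nonneg, rule penalty_nonneg)
  have "cost + (h \<bullet> (Omega_mat \<mu> W *v h) + lam * (LINT z:{0..1}|lborel. ?d2 z)) \<le> cost"
    using le cost_nonneg unfolding dec(2) criterion_spl by (subst (asm) ennreal_le_iff)
  then have h0: "h \<bullet> (Omega_mat \<mu> W *v h) = 0" and "lam * (LINT z:{0..1}|lborel. ?d2 z) = 0"
    using nn by linarith+
  then have d0: "(LINT z:{0..1}|lborel. ?d2 z) = 0"
    using lam_pos by simp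
  have "h = 0"
    by (rule Omega_pos_def[OF prob_space_axioms sets_mu support W_inj h0])
  have "AE z in lborel. indicator {0..1} z * ?d2 z = 0"
    using dec(1) d0 unfolding set_integrable_def set_lebesgue_integral_def
    by (subst (asm) integral_nonneg_eq_0_iff_AE) auto
  then have AE: "AE z in lborel. z \<in> {0..1} \<longrightarrow> second_deriv g z = spline_curv Z \<delta> z"
    by eventually_elim auto
  define b where "b = g 0 - spl 0"
  define c where "c = first_deriv g 0 - first_deriv spl 0"
  have affine: "g z - spl z = b + c * z" if z: "z \<in> {0..1}" for z
  proof -
    have "(LINT t:{0..z}|lborel. (z - t) * second_deriv g t)
        = (LINT t:{0..z}|lborel. (z - t) * spline_curv Z \<delta> t)"
    proof -
      have "set_integrable lborel {0..z} (second_deriv g)"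
        by (rule set_integrable_subset[of lborel "{0..1}" "second_deriv g"])
          (use ac_density_second_deriv[OF g] z in \<open>auto simp: ac_density_def\<close>)
      then have "set_integrable lborel {0..z} (\<lambda>t. (z - t) * second_deriv g t)"
        by (rule set_integrable_mult_continuous) (intro continuous_intros)
      then have [measurable]: "(\<lambda>t. indicator {0..z} t *\<^sub>R ((z - t) * second_deriv g t)) \<in> borel_measurable lborel"
        unfolding set_integrable_def by (rule borel_measurable_integrable)
      show ?thesis
        unfolding set_lebesgue_integral_def
      proof (rule integral_cong_AE)
        show "AE t in lborel. indicator {0..z} t *\<^sub>R ((z - t) * second_deriv g t)
            = indicator {0..z} t *\<^sub>R ((z - t) * spline_curv Z \<delta> t)"
          using AE by eventually_elim (use z in \<open>auto simp: indicator_def\<close>)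
      qed measurable
    qed
    then show ?thesis
      using ac_taylor[OF has_vector_derivative_first_deriv[OF g] ac_density_second_deriv[OF g] z]
        ac_taylor[OF has_vector_derivative_first_deriv[OF restrict_spline_fun_in_function_class]
          ac_density_spline_curv z, of Z \<delta> a]
      unfolding b_def c_def left_diff_distrib by linarith
  qed
  have "b + c * Z $ i = 0" for i
    using affine[OF Z_range[of i]] \<open>h = 0\<close> unfolding spl_knots by (simp add: h_def vec_eq_iff)
  from affine_eq_0[OF this] have "g z = spl z" if "z \<in> {0..1}" for z
    using affine[OF that] by simp
  \<comment> \<open>Both functions are extensional, so agreement on the unit interval is
    equality.\<close>
  moreover have "g \<in> extensional {0..1}"
    using g by (simp add: function_class_def)
  ultimately show ?thesis
    by (intro extensionalityI[of _ "{0..1}"]) auto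
qed

lemma is_arg_min_iff: "is_arg_min (crit Y) (\<lambda>g. g \<in> function_class) g \<longleftrightarrow> g = spl"
  unfolding is_arg_min_def
  using criterion_spl_le eq_spl_if_criterion_le restrict_spline_fun_in_function_class
  by (metis not_le)

text \<open>For the converse, two representations of the same function differ by a constrained
  spline that vanishes at all knots, so their coefficients coincide.\<close>

lemma spline_system_iff_representation:
  "spline_system Y Z W \<mu> lam \<delta>' a' \<longleftrightarrow>
     (\<Sum>i\<in>UNIV. \<delta>' $ i) = 0 \<and> (\<Sum>i\<in>UNIV. \<delta>' $ i * Z $ i) = 0 \<and>
     (\<forall>z\<in>{0..1}. spl z = spline_fun Z \<delta>' a' z)" (is "?L \<longleftrightarrow> ?R")
proof
  assume ?L
  then have "\<delta>' = \<delta> \<and> a' = a"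
    using spline_system_unique_solution[of Y] sys by auto
  with \<open>?L\<close> show ?R
    by (simp add: spline_system_iff)
next
  assume R: ?R
  have "(\<Sum>i\<in>UNIV. (\<delta>' - \<delta>) $ i) = 0" "(\<Sum>i\<in>UNIV. (\<delta>' - \<delta>) $ i * Z $ i) = 0"
    using R sys by (auto simp: spline_system_iff sum_subtractf left_diff_distrib)
  moreover have "spline_fun Z (\<delta>' - \<delta>) (a' - a) (Z $ i) = 0" for i
    using R Z_range[of i] spl_knots[of i] by (simp add: spline_fun_diff)
  ultimately have "\<delta>' - \<delta> = 0" "a' - a = 0"
    by (rule spline_knots_eq_0)+
  with sys show ?L
    by simp
qed

end

end

section \<open>Natural cubic splines\<close>

text \<open>\<open>e\<close> records on which side of each knot \<open>x\<close> lies. Signs equal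
  their own cubes, so the polynomial depends only on the sign pattern.\<close>

lemma spline_fun_eq_poly:
  assumes "\<And>i. \<bar>x - Z $ i\<bar> = e i * (x - Z $ i)" and "\<And>i. e i = 1 \<or> e i = - 1"
  shows "spline_fun Z \<delta> a x
    = poly ([:a $ 1, a $ 2:] + smult (1 / 12) (\<Sum>i\<in>UNIV. smult (\<delta> $ i * e i) ([:- Z $ i, 1:] ^ 3))) x"
proof -
  have "\<bar>x - Z $ i\<bar> ^ 3 = e i * (x - Z $ i) ^ 3" for i
    using assms(2)[of i] by (auto simp: assms(1) power_mult_distrib simp del: abs_if)
  then show ?thesis
    by (simp add: spline_fun_def poly_sum poly_power mult_ac)
qed

lemma degree_spline_poly_le:
  fixes Z :: "real^'n"
  shows "degree ([:b, c:] + smult (1 / 12) (\<Sum>i\<in>UNIV. smult (f i) ([:- Z $ i, 1:] ^ 3))) \<le> 3"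
proof (rule degree_add_le)
  have "degree ([:- Z $ i, 1:] ^ 3) \<le> 3" for i
    using degree_power_le[of "[:- Z $ i, 1:]" 3] by simp
  then have "degree (\<Sum>i\<in>UNIV. smult (f i) ([:- Z $ i, 1:] ^ 3)) \<le> 3"
    by (intro degree_sum_le) (auto intro: order_trans[OF degree_smult_le])
  then show "degree (smult (1 / 12) (\<Sum>i\<in>UNIV. smult (f i) ([:- Z $ i, 1:] ^ 3))) \<le> 3"
    by (rule order_trans[OF degree_smult_le])
qed (rule order_trans[OF degree_pCons_le], simp)

text \<open>The coefficients of \<open>x ^ 3\<close> and \<open>x ^ 2\<close> are multiples of the
  two vanishing sums.\<close>

lemma sum_cubes_eq_affine:
  fixes Z \<delta> :: "real^'n"
  assumes "(\<Sum>i\<in>UNIV. \<delta> $ i) = 0" and "(\<Sum>i\<in>UNIV. \<delta> $ i * Z $ i) = 0"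
  shows "(\<Sum>i\<in>UNIV. \<delta> $ i * (x - Z $ i) ^ 3)
    = 3 * x * (\<Sum>i\<in>UNIV. \<delta> $ i * (Z $ i)\<^sup>2) - (\<Sum>i\<in>UNIV. \<delta> $ i * Z $ i ^ 3)"
proof -
  have "(\<Sum>i\<in>UNIV. \<delta> $ i * (x - Z $ i) ^ 3) = (\<Sum>i\<in>UNIV. x ^ 3 * \<delta> $ i - 3 * x\<^sup>2 * (\<delta> $ i * Z $ i)
      + 3 * x * (\<delta> $ i * (Z $ i)\<^sup>2) - \<delta> $ i * Z $ i ^ 3)"
    by (intro sum.cong refl) (simp add: power2_eq_square power3_eq_cube algebra_simps)
  then show ?thesis
    using assms by (simp add: sum.distrib sum_subtractf flip: sum_distrib_left)
qed

lemma natural_cubic_spline_spline_fun: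
  fixes Z \<delta> :: "real^'n"
  assumes \<delta>: "(\<Sum>i\<in>UNIV. \<delta> $ i) = 0" "(\<Sum>i\<in>UNIV. \<delta> $ i * Z $ i) = 0"
  shows "natural_cubic_spline (range (\<lambda>i. Z $ i)) (spline_fun Z \<delta> a)"
  unfolding natural_cubic_spline_def
proof (intro conjI ballI impI)
  let ?K = "range (\<lambda>i. Z $ i)"
  fix u v assume K: "u \<in> ?K" "v \<in> ?K" and uv: "u < v \<and> {u<..<v} \<inter> ?K = {}"
  \<comment> \<open>No knot lies strictly between \<open>u\<close> and \<open>v\<close>, so one
    choice of signs serves the whole closed interval; at an end point that is a knot the difference
    is zero.\<close>
  define e where "e = (\<lambda>i. if Z $ i \<le> u then 1 else - 1 :: real)"
  have "Z $ i \<le> u \<or> v \<le> Z $ i" for i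
  proof (rule ccontr)
    assume "\<not> ?thesis"
    then have "Z $ i \<in> {u<..<v} \<inter> ?K"
      by auto
    with uv show False
      by simp
  qed
  then have abs: "\<bar>x - Z $ i\<bar> = e i * (x - Z $ i)" if "x \<in> {u..v}" for i x
    using that by (force simp: e_def)
  define p where "p = [:a $ 1, a $ 2:]
    + smult (1 / 12) (\<Sum>i\<in>UNIV. smult (\<delta> $ i * e i) ([:- Z $ i, 1:] ^ 3))"
  have "degree p \<le> 3"
    unfolding p_def by (rule degree_spline_poly_le)
  moreover have "spline_fun Z \<delta> a x = poly p x" if "x \<in> {u..v}" for x
    unfolding p_def by (rule spline_fun_eq_poly[OF abs[OF that]]) (simp add: e_def)
  ultimately show "\<exists>p. degree p \<le> 3 \<and> (\<forall>x\<in>{u..v}. spline_fun Z \<delta> a x = poly p x)"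
    by blast
next
  show "\<exists>s' s''. (\<forall>x. (spline_fun Z \<delta> a has_real_derivative s' x) (at x)) \<and>
      (\<forall>x. (s' has_real_derivative s'' x) (at x)) \<and> continuous_on UNIV s''"
    using spline_fun_deriv spline_slope_deriv continuous_on_spline_curv by blast
next
  let ?K = "range (\<lambda>i. Z $ i)"
  let ?q = "\<Sum>i\<in>UNIV. \<delta> $ i * (Z $ i)\<^sup>2" and ?r = "\<Sum>i\<in>UNIV. \<delta> $ i * Z $ i ^ 3"
  \<comment> \<open>Beyond the outermost knots all differences share one sign \<open>e\<close>, so
    the cubes combine as in \<open>sum_cubes_eq_affine\<close>.\<close>
  have outside: "\<exists>c d. \<forall>x\<in>A. spline_fun Z \<delta> a x = c + d * x"
    if abs: "\<And>x i. x \<in> A \<Longrightarrow> \<bar>x - Z $ i\<bar> ^ 3 = e * (x - Z $ i) ^ 3" for A e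
  proof (intro exI ballI)
    fix x assume "x \<in> A"
    then have "(\<Sum>i\<in>UNIV. \<delta> $ i * \<bar>x - Z $ i\<bar> ^ 3) = e * (\<Sum>i\<in>UNIV. \<delta> $ i * (x - Z $ i) ^ 3)"
      by (simp add: abs sum_distrib_left mult_ac)
    then show "spline_fun Z \<delta> a x = (a $ 1 - e * ?r / 12) + (a $ 2 + e * ?q / 4) * x"
      by (simp add: spline_fun_def sum_cubes_eq_affine[OF \<delta>] field_simps)
  qed
  have "\<bar>x - Z $ i\<bar> ^ 3 = - 1 * (x - Z $ i) ^ 3" if "x \<in> {..<Min ?K}" for x i
  proof -
    have "\<bar>x - Z $ i\<bar> = - (x - Z $ i)"
      using that by (auto simp: less_eq_real_def)
    then show ?thesis
      using power_minus_odd[of 3 "x - Z $ i"] by (simp only:) simp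
  qed
  from outside[of "{..<Min ?K}" "- 1", OF this] show "\<exists>c d. \<forall>x<Min ?K. spline_fun Z \<delta> a x = c + d * x"
    unfolding Ball_def lessThan_iff greaterThan_iff .
  have "\<bar>x - Z $ i\<bar> ^ 3 = 1 * (x - Z $ i) ^ 3" if "x \<in> {Max ?K<..}" for x i
    using that by (simp add: less_imp_le)
  from outside[of "{Max ?K<..}" 1, OF this] show "\<exists>c d. \<forall>x>Max ?K. spline_fun Z \<delta> a x = c + d * x"
    unfolding Ball_def lessThan_iff greaterThan_iff .
qed

text \<open>The equivalence of \<open>is_arg_min\<close> with \<open>g = ghat\<close> carries
  existence and uniqueness together. The formula for the knot values is conditional because
  \<open>matrix_inv\<close> yields an inverse only for an invertible argument.\<close>

theorem proposition1:
  fixes Y Z :: "real^'n" and W :: "real^'p^'n" and \<mu> :: "(real^'p) measure" and lam :: real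
  assumes "CARD('n) \<ge> 2"
    and "\<And>i. Z $ i \<in> {0..1}"
    and "prob_space \<mu>" and "sets \<mu> = sets borel"
    and "symmetric_measure \<mu>" and "measure_support \<mu> = UNIV"
    and "lam > 0"
    and "inj (\<lambda>i. Z $ i)" and "inj (\<lambda>i. W $ i)"
  shows "\<exists>ghat.
    (\<forall>g. is_arg_min (criterion Y Z W \<mu> lam) (\<lambda>g. g \<in> function_class) g \<longleftrightarrow> g = ghat) \<and>
    (\<exists>s. natural_cubic_spline (range (\<lambda>i. Z $ i)) s \<and> ghat = restrict s {0..1}) \<and>
    invertible (Omega_mat \<mu> W) \<and>
    (\<exists>!(\<delta>, a). spline_system Y Z W \<mu> lam \<delta> a) \<and>
    (\<forall>\<delta> a. spline_system Y Z W \<mu> lam \<delta> a \<longleftrightarrow>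
       (\<Sum>i\<in>UNIV. \<delta> $ i) = 0 \<and> (\<Sum>i\<in>UNIV. \<delta> $ i * Z $ i) = 0 \<and>
       (\<forall>z\<in>{0..1}. ghat z = a $ 1 + a $ 2 * z + 1 / 12 * (\<Sum>i\<in>UNIV. \<delta> $ i * \<bar>z - Z $ i\<bar> ^ 3))) \<and>
    (invertible (E_tilde Z W \<mu> lam) \<longrightarrow>
       invertible (transpose (Z_mat Z) ** matrix_inv (E_tilde Z W \<mu> lam) ** Z_mat Z) \<and>
       (\<chi> i. ghat (Z $ i)) =
         (P_mat Z W \<mu> lam
           + E_mat Z ** matrix_inv (E_tilde Z W \<mu> lam) ** (mat 1 - P_mat Z W \<mu> lam)) *v Y)"
proof -
  interpret smoothing_spline Z \<mu> W lam
    using assms by (intro smoothing_spline.intro spline_knots.intro smoothing_spline_axioms.intro)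
  obtain \<delta> a where sys: "spline_system Y Z W \<mu> lam \<delta> a"
    using spline_system_unique_solution[of Y] by auto
  have nat: "(\<Sum>i\<in>UNIV. \<delta> $ i) = 0" "(\<Sum>i\<in>UNIV. \<delta> $ i * Z $ i) = 0"
    using sys by (auto simp: spline_system_iff)
  have knots: "(\<chi> i. restrict (spline_fun Z \<delta> a) {0..1} (Z $ i)) = E_mat Z *v \<delta> + Z_mat Z *v a"
    unfolding spl_knots[OF sys] by (rule spline_fun_knots)
  show ?thesis
  proof (rule exI[of _ "restrict (spline_fun Z \<delta> a) {0..1}"], unfold knots, intro conjI allI)
    show "\<exists>s. natural_cubic_spline (range (\<lambda>i. Z $ i)) s \<and>
        restrict (spline_fun Z \<delta> a) {0..1} = restrict s {0..1}"
      using natural_cubic_spline_spline_fun[OF nat] by blast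
    show "invertible (E_tilde Z W \<mu> lam) \<longrightarrow>
       invertible (transpose (Z_mat Z) ** matrix_inv (E_tilde Z W \<mu> lam) ** Z_mat Z) \<and>
       E_mat Z *v \<delta> + Z_mat Z *v a =
         (P_mat Z W \<mu> lam
           + E_mat Z ** matrix_inv (E_tilde Z W \<mu> lam) ** (mat 1 - P_mat Z W \<mu> lam)) *v Y"
      using closed_form[OF sys] by simp
    show "spline_system Y Z W \<mu> lam \<delta>' a' \<longleftrightarrow>
       (\<Sum>i\<in>UNIV. \<delta>' $ i) = 0 \<and> (\<Sum>i\<in>UNIV. \<delta>' $ i * Z $ i) = 0 \<and>
       (\<forall>z\<in>{0..1}. restrict (spline_fun Z \<delta> a) {0..1} z
          = a' $ 1 + a' $ 2 * z + 1 / 12 * (\<Sum>i\<in>UNIV. \<delta>' $ i * \<bar>z - Z $ i\<bar> ^ 3))" for \<delta>' a'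
      using spline_system_iff_representation[OF sys, of \<delta>' a'] unfolding spline_fun_def[of Z \<delta>' a'] .
  qed (rule is_arg_min_iff[OF sys] Omega_invertible spline_system_unique_solution)+
qed

end
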